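(* Let $k\subset K$ be an FIP field extension, with separable closure $T$ (of $k$ in $K$) and radicial closure $U$ (of $k$ in $K$), such that $U,T\notin\{k,K\}$. Then $k\subset K$ is Boolean if and only if the following conditions hold: (1) $k\subset U$ and $T\subset K$ are minimal. (2) $[k,K]=[k,T]\cup[U,K]$. (3) $k\subset T$ and $k\subset U$ are linearly disjoint. (4) $[k,T]$ is a Boolean lattice. If these conditions hold, then $[k,T]\cap[U,K]=\emptyset$ and $U$ is the complement of $T$ in $[k,K]$.
   Context: For a ring extension $R\subseteq S$, $[R,S]$ is the set of all $R$-subalgebras of $S$, a complete lattice under inclusion, with infimum the intersection and supremum (product) the compositum. FIP means $[R,S]$ is finite (for fields this forces the extension to be algebraic, and then $[k,K]$ is the set of intermediate fields). The extension is minimal if $R\ne S$ and $[R,S]=\{R,S\}$. It is Boolean if the lattice $[R,S]$ is Boolean, i.e. distributive and each $V\in[R,S]$ has a (unique) complement $V'$, meaning $V\cap V'=R$ and $VV'=S$. "Radicial" means purely inseparable; the radicial closure of $k$ in $K$ is the set of elements of $K$ purely inseparable over $k$, the separable closure is the set of elements of $K$ separable over $k$. $\subset$ denotes proper inclusion. *)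

theory Defs
  imports "HOL-Computational_Algebra.Computational_Algebra" "HOL-Algebra.Algebraic_Closure_Type"
begin

text \<open>
  All rings and fields below are subsets of an arbitrary ambient field, the type \<open>'a :: field\<close>. An
  abstract field extension is an instance with the larger field as the ambient one.
\<close>

definition is_subring :: "'a::field set \<Rightarrow> bool" where
  "is_subring R \<longleftrightarrow> 0 \<in> R \<and> 1 \<in> R \<and>
     (\<forall>x\<in>R. \<forall>y\<in>R. x + y \<in> R) \<and> (\<forall>x\<in>R. \<forall>y\<in>R. x * y \<in> R) \<and> (\<forall>x\<in>R. - x \<in> R)"

definition is_subfield :: "'a::field set \<Rightarrow> bool" where
  "is_subfield F \<longleftrightarrow> is_subring F \<and> (\<forall>x\<in>F. x \<noteq> 0 \<longrightarrow> inverse x \<in> F)"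


section \<open>The lattice of subalgebras of a ring extension\<close>

text \<open>\<open>subalgs R S\<close> is $[R,S]$. An \<open>R\<close>-subalgebra of \<open>S\<close> is the same as a subring lying
  between \<open>R\<close> and \<open>S\<close>; it is not required to be a field.\<close>

definition subalgs :: "'a::field set \<Rightarrow> 'a set \<Rightarrow> 'a set set" where
  "subalgs R S = {V. is_subring V \<and> R \<subseteq> V \<and> V \<subseteq> S}"

definition FIP :: "'a::field set \<Rightarrow> 'a set \<Rightarrow> bool" where
  "FIP R S \<longleftrightarrow> finite (subalgs R S)"

definition minimal_ext :: "'a::field set \<Rightarrow> 'a set \<Rightarrow> bool" where
  "minimal_ext R S \<longleftrightarrow> R \<noteq> S \<and> subalgs R S = {R, S}"

definition compositum :: "'a::field set \<Rightarrow> 'a set \<Rightarrow> 'a set" where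
  "compositum V W = \<Inter>{A. is_subring A \<and> V \<subseteq> A \<and> W \<subseteq> A}"

definition is_complement :: "'a::field set \<Rightarrow> 'a set \<Rightarrow> 'a set \<Rightarrow> 'a set \<Rightarrow> bool" where
  "is_complement R S V V' \<longleftrightarrow>
     V \<in> subalgs R S \<and> V' \<in> subalgs R S \<and> V \<inter> V' = R \<and> compositum V V' = S"

text \<open>Uniqueness of complements is a consequence of distributivity.\<close>

definition boolean_ext :: "'a::field set \<Rightarrow> 'a set \<Rightarrow> bool" where
  "boolean_ext R S \<longleftrightarrow>
     (\<forall>A\<in>subalgs R S. \<forall>B\<in>subalgs R S. \<forall>C\<in>subalgs R S.
        A \<inter> compositum B C = compositum (A \<inter> B) (A \<inter> C)) \<and>
     (\<forall>V\<in>subalgs R S. \<exists>V'. is_complement R S V V')"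


section \<open>Separable and purely inseparable elements\<close>

definition polys_over :: "'a::field set \<Rightarrow> 'a poly set" where
  "polys_over k = {p. \<forall>i. coeff p i \<in> k}"

definition algebraic_over :: "'a::field set \<Rightarrow> 'a \<Rightarrow> bool" where
  "algebraic_over k x \<longleftrightarrow> (\<exists>p\<in>polys_over k. p \<noteq> 0 \<and> poly p x = 0)"

definition min_poly :: "'a::field set \<Rightarrow> 'a \<Rightarrow> 'a poly" where
  "min_poly k x = (THE p. p \<in> polys_over k \<and> Polynomial.lead_coeff p = 1 \<and> poly p x = 0 \<and>
     (\<forall>q\<in>polys_over k. q \<noteq> 0 \<and> poly q x = 0 \<longrightarrow> Polynomial.degree p \<le> Polynomial.degree q))"

text \<open>The minimal polynomial has no multiple root in an algebraic closure of the ambient field; the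
  choice of an algebraically closed field containing \<open>k\<close> does not matter.\<close>

definition separable_over :: "'a::field set \<Rightarrow> 'a \<Rightarrow> bool" where
  "separable_over k x \<longleftrightarrow> algebraic_over k x \<and> rsquarefree (map_poly to_ac (min_poly k x))"

text \<open>\<open>max 1 CHAR('a)\<close> is the characteristic exponent, so that in characteristic \<open>0\<close> only the
  elements of \<open>k\<close> are purely inseparable over \<open>k\<close>.\<close>

definition purely_inseparable_over :: "'a::field set \<Rightarrow> 'a \<Rightarrow> bool" where
  "purely_inseparable_over k x \<longleftrightarrow> (\<exists>n. x ^ (max 1 CHAR('a) ^ n) \<in> k)"

definition separable_closure :: "'a::field set \<Rightarrow> 'a set \<Rightarrow> 'a set" where
  "separable_closure k K = {x\<in>K. separable_over k x}"

definition radicial_closure :: "'a::field set \<Rightarrow> 'a set \<Rightarrow> 'a set" where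
  "radicial_closure k K = {x\<in>K. purely_inseparable_over k x}"


section \<open>Linear disjointness\<close>

definition lin_indep_over :: "'a::field set \<Rightarrow> 'a set \<Rightarrow> bool" where
  "lin_indep_over F B \<longleftrightarrow>
     (\<forall>A c. finite A \<and> A \<subseteq> B \<and> (\<forall>b\<in>A. c b \<in> F) \<and> (\<Sum>b\<in>A. c b * b) = 0 \<longrightarrow> (\<forall>b\<in>A. c b = 0))"

text \<open>For fields \<open>k \<subseteq> E\<close> and \<open>k \<subseteq> F\<close> this is symmetric in \<open>E\<close> and \<open>F\<close>.\<close>

definition linearly_disjoint :: "'a::field set \<Rightarrow> 'a set \<Rightarrow> 'a set \<Rightarrow> bool" where
  "linearly_disjoint k E F \<longleftrightarrow> (\<forall>B\<subseteq>E. lin_indep_over k B \<longrightarrow> lin_indep_over F B)"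

end

theory Submission
  imports Defs
begin

text \<open>
  As \<open>U \<noteq> k\<close>, the characteristic \<open>p\<close> is positive. The basic tool is that an element
  \<open>z \<in> F(x)\<close>, with \<open>x\<close> separable over \<open>F\<close>, lies in \<open>F\<close> as soon as some \<open>p\<close>-power of it does;
  together with the criterion \<open>z \<in> F(z\<^sup>p)\<close> for separability, it shows that \<open>T\<close> is a field.

  If \<open>[k, K]\<close> is Boolean, so are its intervals, and a radicial Boolean extension is minimal. Hence \<open>TU = K\<close>,
  and distributivity gives \<open>L = (L \<inter> T)(L \<inter> U)\<close> for every intermediate \<open>L\<close>, where \<open>L \<inter> U\<close> is \<open>k\<close> or
  \<open>U\<close>. Conversely, \<open>L = (L \<inter> T)U\<close> whenever \<open>U \<subseteq> L\<close>, because \<open>L\<close> is both separable and radicial over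
  the right-hand side. So \<open>L\<close> is determined by \<open>L \<inter> T\<close> and the truth value of \<open>U \<subseteq> L\<close>, both compatible
  with the lattice operations, and \<open>[k, K]\<close> is the product of \<open>[k, T]\<close> and a two-element chain.
\<close>

section \<open>Subrings and subfields\<close>

lemma is_subringD:
  assumes "is_subring R"
  shows "0 \<in> R" "1 \<in> R" "\<And>x y. x \<in> R \<Longrightarrow> y \<in> R \<Longrightarrow> x + y \<in> R"
    "\<And>x y. x \<in> R \<Longrightarrow> y \<in> R \<Longrightarrow> x * y \<in> R" "\<And>x. x \<in> R \<Longrightarrow> - x \<in> R"
    "\<And>x y. x \<in> R \<Longrightarrow> y \<in> R \<Longrightarrow> x - y \<in> R" "\<And>x n. x \<in> R \<Longrightarrow> x ^ n \<in> R"
proof -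
  show R: "0 \<in> R" "1 \<in> R" "\<And>x y. x \<in> R \<Longrightarrow> y \<in> R \<Longrightarrow> x + y \<in> R"
    "\<And>x y. x \<in> R \<Longrightarrow> y \<in> R \<Longrightarrow> x * y \<in> R" "\<And>x. x \<in> R \<Longrightarrow> - x \<in> R"
    using assms by (auto simp: is_subring_def)
  show "x - y \<in> R" if "x \<in> R" "y \<in> R" for x y
    using R(3)[of x "- y"] R(5) that by simp
  show "x ^ n \<in> R" if "x \<in> R" for x n
    by (induction n) (use R that in auto)
qed

lemma is_subring_sum:
  assumes "is_subring R" "\<And>i. i \<in> I \<Longrightarrow> f i \<in> R"
  shows "sum f I \<in> R"
  using assms(2) by (induction I rule: infinite_finite_induct) (auto intro: is_subringD[OF assms(1)])

lemma is_subring_Int: "is_subring R \<Longrightarrow> is_subring S \<Longrightarrow> is_subring (R \<inter> S)"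
  by (auto simp: is_subring_def)

lemma is_subfieldD:
  assumes "is_subfield F"
  shows "is_subring F" "\<And>x. x \<in> F \<Longrightarrow> inverse x \<in> F"
  using assms by (auto simp: is_subfield_def is_subring_def)

lemma polys_over_closed:
  assumes "is_subring R"
  shows "0 \<in> polys_over R" "1 \<in> polys_over R"
    "\<And>a. a \<in> R \<Longrightarrow> [:a:] \<in> polys_over R"
    "\<And>a n. a \<in> R \<Longrightarrow> monom a n \<in> polys_over R"
    "\<And>p q. p \<in> polys_over R \<Longrightarrow> q \<in> polys_over R \<Longrightarrow> p + q \<in> polys_over R"
    "\<And>p q. p \<in> polys_over R \<Longrightarrow> q \<in> polys_over R \<Longrightarrow> p - q \<in> polys_over R"
    "\<And>p q. p \<in> polys_over R \<Longrightarrow> q \<in> polys_over R \<Longrightarrow> p * q \<in> polys_over R"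
    "\<And>p. p \<in> polys_over R \<Longrightarrow> - p \<in> polys_over R"
    "\<And>a p. a \<in> R \<Longrightarrow> p \<in> polys_over R \<Longrightarrow> smult a p \<in> polys_over R"
    "\<And>p q. p \<in> polys_over R \<Longrightarrow> q \<in> polys_over R \<Longrightarrow> pcompose p q \<in> polys_over R"
    "\<And>p. p \<in> polys_over R \<Longrightarrow> pderiv p \<in> polys_over R"
proof -
  note R = is_subringD[OF assms]
  show "0 \<in> polys_over R" "\<And>p q. p \<in> polys_over R \<Longrightarrow> q \<in> polys_over R \<Longrightarrow> p + q \<in> polys_over R"
    "\<And>p q. p \<in> polys_over R \<Longrightarrow> q \<in> polys_over R \<Longrightarrow> p - q \<in> polys_over R"
    "\<And>p. p \<in> polys_over R \<Longrightarrow> - p \<in> polys_over R"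
    "\<And>a p. a \<in> R \<Longrightarrow> p \<in> polys_over R \<Longrightarrow> smult a p \<in> polys_over R"
    "\<And>a n. a \<in> R \<Longrightarrow> monom a n \<in> polys_over R"
    using R by (auto simp: polys_over_def)
  show const: "[:a:] \<in> polys_over R" if "a \<in> R" for a
    using R that by (auto simp: polys_over_def coeff_pCons split: nat.split)
  from const[OF R(2)] show "1 \<in> polys_over R"
    by (simp add: one_pCons)
  show "p * q \<in> polys_over R" if "p \<in> polys_over R" "q \<in> polys_over R" for p q
    using that by (auto simp: polys_over_def coeff_mult intro!: is_subring_sum[OF assms] R)
  show "pcompose p q \<in> polys_over R" if "p \<in> polys_over R" "q \<in> polys_over R" for p q
    unfolding polys_over_def using that R
    by (auto simp: polys_over_def intro!: coeff_pcompose_semiring_closed[where R = R])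
  have "of_nat n \<in> R" for n :: nat
    by (induction n) (use R in auto)
  then show "pderiv p \<in> polys_over R" if "p \<in> polys_over R" for p
    using that R by (auto simp: polys_over_def coeff_pderiv)
qed

lemma polys_over_pCons_iff: "pCons a p \<in> polys_over R \<longleftrightarrow> a \<in> R \<and> p \<in> polys_over R"
proof -
  have "(\<forall>i. coeff (pCons a p) i \<in> R) \<longleftrightarrow> a \<in> R \<and> (\<forall>i. coeff p i \<in> R)"
    by (metis coeff_pCons_0 coeff_pCons_Suc not0_implies_Suc)
  then show ?thesis
    by (simp add: polys_over_def)
qed

lemma polys_over_mono: "R \<subseteq> S \<Longrightarrow> polys_over R \<subseteq> polys_over S"
  by (auto simp: polys_over_def)

lemma poly_in_subring:
  assumes "is_subring R" "p \<in> polys_over R" "x \<in> R"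
  shows "poly p x \<in> R"
  using assms(2) by (induction p)
    (auto simp: polys_over_pCons_iff is_subringD[OF assms(1)] assms(3))

text \<open>Since \<open>q\<close> is monic, each leading term is cancelled without dividing, so all
  coefficients stay in the subring \<open>R\<close>.\<close>

lemma polys_over_division:
  fixes p q :: "'a::field poly"
  assumes R: "is_subring R" and q: "q \<in> polys_over R" "Polynomial.lead_coeff q = 1"
    and "p \<in> polys_over R"
  obtains a r where "a \<in> polys_over R" "r \<in> polys_over R" "p = q * a + r"
    "r = 0 \<or> Polynomial.degree r < Polynomial.degree q"
proof -
  note P = polys_over_closed[OF R]
  have "\<exists>a\<in>polys_over R. \<exists>r\<in>polys_over R. p = q * a + r \<and>
      (r = 0 \<or> Polynomial.degree r < Polynomial.degree q)"
    using assms(4)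
  \<comment> \<open>The measure separates the zero polynomial from nonzero constants, so that
    cancelling a constant down to \<open>0\<close> still counts as a descent.\<close>
  proof (induction "if p = 0 then 0 else Suc (Polynomial.degree p)" arbitrary: p rule: less_induct)
    case less
    show ?case
    proof (cases "p = 0 \<or> Polynomial.degree p < Polynomial.degree q")
      case True
      then show ?thesis
        using less.prems P(1) by (intro bexI[of _ 0] bexI[of _ p]) auto
    next
      case False
      define s where "s = monom (Polynomial.lead_coeff p) (Polynomial.degree p - Polynomial.degree q)"
      have s: "s \<in> polys_over R"
        using less.prems unfolding s_def by (intro P) (auto simp: polys_over_def)
      have deg: "Polynomial.degree (p - s * q) \<le> Polynomial.degree p"
        using False by (intro degree_diff_le order.trans[OF degree_mult_le])
          (auto simp: s_def degree_monom_eq)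
      have "coeff (s * q) (Polynomial.degree p) = Polynomial.lead_coeff p"
        using False q(2) by (simp add: s_def coeff_monom_mult)
      then have "coeff (p - s * q) (Polynomial.degree p) = 0"
        by simp
      then have "p - s * q = 0 \<or> Polynomial.degree (p - s * q) < Polynomial.degree p"
        using deg by (metis leading_coeff_0_iff order_le_less)
      then have "(if p - s * q = 0 then 0 else Suc (Polynomial.degree (p - s * q)))
          < (if p = 0 then 0 else Suc (Polynomial.degree p))"
        using False by auto
      from less.hyps[OF this P(6)[OF less.prems P(7)[OF s q(1)]]]
      obtain a r where ar: "a \<in> polys_over R" "r \<in> polys_over R" "p - s * q = q * a + r"
        "r = 0 \<or> Polynomial.degree r < Polynomial.degree q"
        by blast
      then show ?thesis
        using P(5)[OF s ar(1)] by (intro bexI[of _ "s + a"] bexI[of _ r]) (auto simp: algebra_simps)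
    qed
  qed
  then show ?thesis
    using that by blast
qed

section \<open>Minimal polynomials and simple extensions\<close>

text \<open>This discharges the \<open>THE\<close> in \<open>min_poly\<close>. An annihilator of
  least degree, made monic, exists; two of them are equal, because their difference would be an
  annihilator whose top coefficient cancels.\<close>

lemma min_poly_props:
  assumes F: "is_subfield F" and "algebraic_over F x"
  shows "min_poly F x \<in> polys_over F" "Polynomial.lead_coeff (min_poly F x) = 1"
    "poly (min_poly F x) x = 0"
    "\<And>q. q \<in> polys_over F \<Longrightarrow> q \<noteq> 0 \<Longrightarrow> poly q x = 0 \<Longrightarrow>
      Polynomial.degree (min_poly F x) \<le> Polynomial.degree q"
proof -
  note P = polys_over_closed[OF is_subfieldD(1)[OF F]]
  define Q where "Q q \<longleftrightarrow> q \<in> polys_over F \<and> q \<noteq> 0 \<and> poly q x = 0" for q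
  define M where "M p \<longleftrightarrow> p \<in> polys_over F \<and> Polynomial.lead_coeff p = 1 \<and> poly p x = 0 \<and>
     (\<forall>q\<in>polys_over F. q \<noteq> 0 \<and> poly q x = 0 \<longrightarrow> Polynomial.degree p \<le> Polynomial.degree q)" for p
  obtain m where m: "Q m" "\<And>q. Q q \<Longrightarrow> Polynomial.degree m \<le> Polynomial.degree q"
    using assms(2) exists_least_lemma[of "\<lambda>n. \<exists>q. Q q \<and> Polynomial.degree q = n"]
      ex_has_least_nat[of Q _ Polynomial.degree]
    unfolding algebraic_over_def Q_def by metis
  define m' where "m' = smult (inverse (Polynomial.lead_coeff m)) m"
  have "m' \<in> polys_over F"
    using m(1) unfolding m'_def Q_def
    by (intro P is_subfieldD[OF F]) (auto simp: polys_over_def)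
  then have M: "M m'"
    using m unfolding M_def Q_def by (auto simp: m'_def)
  have uniq: "p = m'" if "M p" for p
  proof (rule ccontr)
    assume ne: "p \<noteq> m'"
    have deg: "Polynomial.degree p = Polynomial.degree m'"
      using that M unfolding M_def by (metis antisym leading_coeff_0_iff zero_neq_one)
    have "Q (p - m')"
      using that M ne P(6) unfolding M_def Q_def by auto
    then have "Polynomial.degree m' \<le> Polynomial.degree (p - m')"
      using M unfolding M_def Q_def by blast
    moreover have "Polynomial.degree (p - m') \<le> Polynomial.degree m'"
      using deg by (intro degree_diff_le) auto
    moreover have "coeff (p - m') (Polynomial.degree m') = 0"
      using that M deg unfolding M_def by simp
    ultimately show False
      using ne by (metis eq_iff_diff_eq_0 le_antisym leading_coeff_0_iff)
  qed
  have "M (min_poly F x)"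
    unfolding min_poly_def M_def[symmetric] using M uniq by (rule theI)
  then show "min_poly F x \<in> polys_over F" "Polynomial.lead_coeff (min_poly F x) = 1"
    "poly (min_poly F x) x = 0"
    "\<And>q. q \<in> polys_over F \<Longrightarrow> q \<noteq> 0 \<Longrightarrow> poly q x = 0 \<Longrightarrow>
      Polynomial.degree (min_poly F x) \<le> Polynomial.degree q"
    unfolding M_def by blast+
qed

lemma poly_mod_min_poly:
  assumes F: "is_subfield F" and x: "algebraic_over F x" and "p \<in> polys_over F"
  obtains a r where "a \<in> polys_over F" "r \<in> polys_over F" "p = min_poly F x * a + r"
    "poly r x = poly p x" "r = 0 \<or> Polynomial.degree r < Polynomial.degree (min_poly F x)"
proof -
  note m = min_poly_props[OF F x]
  obtain a r where "a \<in> polys_over F" "r \<in> polys_over F" "p = min_poly F x * a + r"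
    "r = 0 \<or> Polynomial.degree r < Polynomial.degree (min_poly F x)"
    by (rule polys_over_division[OF is_subfieldD(1)[OF F] m(1,2) assms(3)])
  then show ?thesis
    using m(3) that by simp
qed

lemma min_poly_dvd:
  assumes F: "is_subfield F" and x: "algebraic_over F x" and p: "p \<in> polys_over F" "poly p x = 0"
  obtains a where "a \<in> polys_over F" "p = min_poly F x * a"
proof -
  obtain a r where ar: "a \<in> polys_over F" "r \<in> polys_over F" "p = min_poly F x * a + r"
    "poly r x = poly p x" "r = 0 \<or> Polynomial.degree r < Polynomial.degree (min_poly F x)"
    by (rule poly_mod_min_poly[OF F x p(1)])
  then have "r = 0"
    using min_poly_props(4)[OF F x] p(2) by fastforce
  then show ?thesis
    using ar that by simp
qed

text \<open>Write the minimal polynomial as \<open>a + X q\<close>. By minimality \<open>q\<close>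
  does not vanish at \<open>x\<close>, so \<open>a \<noteq> 0\<close> and the inverse of
  \<open>x\<close> is \<open>- q(x) / a\<close>, a polynomial in \<open>x\<close>.\<close>

lemma inverse_algebraic_in_subring:
  assumes F: "is_subfield F" and R: "is_subring R" "F \<subseteq> R" and x: "x \<in> R" "algebraic_over F x"
  shows "inverse x \<in> R"
proof (cases "x = 0")
  case True
  then show ?thesis
    using x by simp
next
  case False
  note m = min_poly_props[OF F x(2)]
  obtain a q where aq: "min_poly F x = pCons a q"
    using pCons_cases by blast
  have q: "a \<in> F" "q \<in> polys_over F"
    using m(1) aq polys_over_pCons_iff by metis+
  have rel: "a + x * poly q x = 0"
    using m(3) aq by simp
  have "q \<noteq> 0"
    using m(2,3) aq by auto
  moreover from this have "Polynomial.degree q < Polynomial.degree (min_poly F x)"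
    using aq by simp
  ultimately have "poly q x \<noteq> 0"
    using m(4)[OF q(2)] by auto
  then have "a \<noteq> 0"
    using rel False by auto
  then have "inverse x = - (inverse a * poly q x)"
    using rel False by (simp add: field_simps add_eq_0_iff)
  moreover have "poly q x \<in> R"
    using poly_in_subring[OF R(1) _ x(1)] polys_over_mono[OF R(2)] q(2) by blast
  ultimately show ?thesis
    using is_subfieldD(2)[OF F q(1)] R(2) by (auto intro!: is_subringD[OF R(1)])
qed

lemma is_subfield_between:
  assumes "is_subfield F" "is_subring R" "F \<subseteq> R" "\<And>x. x \<in> R \<Longrightarrow> algebraic_over F x"
  shows "is_subfield R"
  using assms inverse_algebraic_in_subring unfolding is_subfield_def by metis

text \<open>This is the ring \<open>F[x]\<close>. It coincides with the field \<open>F(x)\<close>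
  once \<open>x\<close> is algebraic, by \<open>is_subfield_adjoin\<close>.\<close>

definition adjoin :: "'a::field set \<Rightarrow> 'a \<Rightarrow> 'a set" where
  "adjoin F x = (\<lambda>q. poly q x) ` polys_over F"

lemma adjoin_self: "is_subring F \<Longrightarrow> x \<in> adjoin F x"
  unfolding adjoin_def
  by (rule image_eqI[of _ _ "[:0, 1:]"]) (auto simp: polys_over_pCons_iff is_subringD polys_over_closed)

lemma subset_adjoin: "is_subring F \<Longrightarrow> F \<subseteq> adjoin F x"
  unfolding adjoin_def
  by (intro subsetI, rule_tac x = "[:xa:]" in image_eqI) (auto simp: polys_over_closed)

lemma adjoin_least: "is_subring R \<Longrightarrow> F \<subseteq> R \<Longrightarrow> x \<in> R \<Longrightarrow> adjoin F x \<subseteq> R"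
  unfolding adjoin_def using poly_in_subring polys_over_mono by blast

lemma is_subring_adjoin:
  assumes "is_subring F"
  shows "is_subring (adjoin F x)"
proof -
  note P = polys_over_closed[OF assms]
  have "poly p x + poly q x \<in> adjoin F x" "poly p x * poly q x \<in> adjoin F x" "- poly p x \<in> adjoin F x"
    if "p \<in> polys_over F" "q \<in> polys_over F" for p q
    unfolding adjoin_def poly_add[symmetric] poly_mult[symmetric] poly_minus[symmetric]
    using P(5,7)[OF that] P(8)[OF that(1)] by blast+
  moreover have "0 \<in> adjoin F x" "1 \<in> adjoin F x"
    using subset_adjoin[OF assms] is_subringD[OF assms] by blast+
  ultimately show ?thesis
    unfolding is_subring_def by (auto simp: adjoin_def)
qed

lemma algebraic_over_mono: "F \<subseteq> E \<Longrightarrow> algebraic_over F x \<Longrightarrow> algebraic_over E x"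
  unfolding algebraic_over_def using polys_over_mono by blast

lemma algebraic_over_power:
  fixes x :: "'a::field"
  assumes F: "is_subring F" and "x ^ n \<in> F" "n > 0"
  shows "algebraic_over F x"
  unfolding algebraic_over_def
proof (intro bexI[of _ "monom 1 n - [:x ^ n:]"] conjI)
  show "monom 1 n - [:x ^ n:] \<noteq> 0"
  proof
    assume "monom 1 n - [:x ^ n:] = 0"
    then have "coeff (monom 1 n - [:x ^ n:]) n = 0"
      by simp
    then show False
      using assms(3) by (simp add: coeff_pCons split: nat.splits)
  qed
qed (use assms in \<open>auto simp: poly_monom intro!: polys_over_closed is_subringD(2)\<close>)

text \<open>A Euclidean descent on the degree of \<open>p\<close>: dividing the minimal polynomial
  by \<open>p\<close> leaves a remainder \<open>r\<close> whose value at \<open>x\<close> is a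
  multiple of that of \<open>p\<close>, so an inverse of \<open>r(x)\<close> yields one of
  \<open>p(x)\<close>. Working with polynomials in \<open>x\<close> avoids asking whether
  \<open>p(x)\<close> is itself algebraic.\<close>

lemma inverse_poly_over:
  assumes F: "is_subfield F" and x: "algebraic_over F x" and "p \<in> polys_over F" "poly p x \<noteq> 0"
  obtains b where "b \<in> polys_over F" "poly b x * poly p x = 1"
proof -
  note P = polys_over_closed[OF is_subfieldD(1)[OF F]]
  note m = min_poly_props[OF F x]
  have low: "\<exists>b\<in>polys_over F. poly b x * poly p x = 1"
    if "p \<in> polys_over F" "poly p x \<noteq> 0" "Polynomial.degree p < Polynomial.degree (min_poly F x)" for p
    using that
  proof (induction "Polynomial.degree p" arbitrary: p rule: less_induct)
    case less
    define c where "c = Polynomial.lead_coeff p"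
    have c: "c \<in> F" "inverse c \<in> F" "c \<noteq> 0"
      using less.prems is_subfieldD(2)[OF F] by (auto simp: c_def polys_over_def)
    define p' where "p' = smult (inverse c) p"
    have p': "p' \<in> polys_over F" "Polynomial.lead_coeff p' = 1"
      "Polynomial.degree p' = Polynomial.degree p" "p = smult c p'"
      using less.prems c by (auto simp: p'_def c_def intro: P)
    obtain q r where qr: "q \<in> polys_over F" "r \<in> polys_over F" "min_poly F x = p' * q + r"
      "r = 0 \<or> Polynomial.degree r < Polynomial.degree p'"
      by (rule polys_over_division[OF is_subfieldD(1)[OF F] p'(1,2) m(1)])
    show ?case
    proof (cases "r = 0")
      case True
      \<comment> \<open>Here \<open>q\<close> vanishes at \<open>x\<close>, so the minimal degree of
        \<open>p' * q\<close> forces \<open>p'\<close> to be constant.\<close>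
      then have "poly p' x * poly q x = 0"
        using m(3) qr(3) by simp
      then have "poly q x = 0"
        using less.prems(2) p'(4) by auto
      moreover have ne: "p' * q \<noteq> 0"
        using m(2) qr(3) True by auto
      ultimately have "Polynomial.degree (p' * q) \<le> Polynomial.degree q"
        using m(4)[OF qr(1)] qr(3) True by auto
      then have "Polynomial.degree p' = 0"
        using ne by (simp add: degree_mult_eq)
      then obtain a where "p = [:a:]"
        using p'(3) degree_eq_zeroE by metis
      then have "p = [:c:]"
        by (simp add: c_def)
      then show ?thesis
        using c by (intro bexI[of _ "[:inverse c:]"] P) auto
    next
      case False
      then have "Polynomial.degree r < Polynomial.degree p"
        using qr(4) p'(3) by simp
      moreover from this have "poly r x \<noteq> 0"
        using m(4)[OF qr(2) False] less.prems(3) by linarith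
      ultimately obtain b where b: "b \<in> polys_over F" "poly b x * poly r x = 1"
        using less.hyps[OF _ qr(2)] less.prems(3) by fastforce
      have "poly r x = - (poly p' x * poly q x)"
        using m(3) qr(3) by (simp add: add_eq_0_iff2)
      then have "poly (- smult (inverse c) (b * q)) x * poly p x = 1"
        using b(2) c(3) p'(4) by (simp add: field_simps)
      moreover have "- smult (inverse c) (b * q) \<in> polys_over F"
        by (intro P c b qr)
      ultimately show ?thesis
        by blast
    qed
  qed
  obtain r where "r \<in> polys_over F" "poly r x = poly p x"
    "r = 0 \<or> Polynomial.degree r < Polynomial.degree (min_poly F x)"
    by (rule poly_mod_min_poly[OF F x assms(3)])
  then show ?thesis
    using low[of r] assms(4) that by auto
qed

lemma is_subfield_adjoin:
  assumes F: "is_subfield F" and x: "algebraic_over F x"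
  shows "is_subfield (adjoin F x)"
  unfolding is_subfield_def
proof (intro conjI ballI impI)
  show "is_subring (adjoin F x)"
    using is_subring_adjoin is_subfieldD(1)[OF F] .
  fix y assume y: "y \<in> adjoin F x" "y \<noteq> 0"
  then obtain p where p: "p \<in> polys_over F" "y = poly p x"
    by (auto simp: adjoin_def)
  then obtain b where "b \<in> polys_over F" "poly b x * y = 1"
    using inverse_poly_over[OF F x] y(2) by metis
  then show "inverse y \<in> adjoin F x"
    using inverse_unique[of y "poly b x"] by (auto simp: adjoin_def mult.commute)
qed

section \<open>Separable elements in positive characteristic\<close>

text \<open>At a root \<open>a\<close>, write \<open>p = (X - a) q\<close>. The order of
  \<open>a\<close> in \<open>p\<close> is one more than in \<open>q\<close>, and the derivative of
  \<open>p\<close> takes the value \<open>q(a)\<close> at \<open>a\<close>.\<close>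

lemma rsquarefree_iff_no_common_root:
  fixes p :: "'a::field poly"
  assumes "p \<noteq> 0"
  shows "rsquarefree p \<longleftrightarrow> (\<forall>a. \<not> (poly p a = 0 \<and> poly (pderiv p) a = 0))"
proof -
  have "\<not> (poly p a = 0 \<and> poly (pderiv p) a = 0) \<longleftrightarrow> Polynomial.order a p = 0 \<or> Polynomial.order a p = 1" for a
  proof (cases "poly p a = 0")
    case True
    then obtain q where q: "p = [:-a, 1:] * q"
      using poly_eq_0_iff_dvd by blast
    have "q \<noteq> 0"
      using q assms by auto
    have "Polynomial.order a p = 1 + Polynomial.order a q"
      using q assms order_mult[of "[:-a, 1:]" q a] by (simp add: order_power_n_n[of a 1, simplified])
    moreover have "poly (pderiv p) a = poly q a"
      unfolding q pderiv_mult by (simp add: pderiv_pCons)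
    ultimately show ?thesis
      using True \<open>q \<noteq> 0\<close> order_root[of q a] by auto
  next
    case False
    then show ?thesis
      by (simp add: order_0I)
  qed
  then show ?thesis
    using assms by (simp add: rsquarefree_def)
qed

lemma poly_map_to_ac: "poly (map_poly to_ac p) (to_ac x) = to_ac (poly p x)"
  by (induction p) (auto simp: map_poly_pCons)

lemma pderiv_map_to_ac: "pderiv (map_poly to_ac p) = map_poly to_ac (pderiv p)"
  by (rule poly_eqI) (simp add: coeff_pderiv coeff_map_poly)

lemma map_to_ac_add: "map_poly to_ac (p + q) = map_poly to_ac p + map_poly to_ac q"
  by (rule poly_eqI) (simp add: coeff_map_poly)

lemma map_to_ac_mult: "map_poly to_ac (p * q) = map_poly to_ac p * map_poly to_ac q"
  by (rule poly_eqI) (simp add: coeff_map_poly coeff_mult to_ac_sum)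

text \<open>If \<open>b\<close> inverts the derivative at \<open>x\<close>, then
  \<open>1 - pderiv m * b\<close> vanishes at \<open>x\<close> and is a multiple of the minimal
  polynomial \<open>m\<close>. Being an identity of polynomials, the result can be carried to any
  larger field.\<close>

lemma min_poly_pderiv_bezout:
  assumes F: "is_subfield F" and x: "algebraic_over F x" and "poly (pderiv (min_poly F x)) x \<noteq> 0"
  obtains a b where "min_poly F x * a + pderiv (min_poly F x) * b = 1"
proof -
  note P = polys_over_closed[OF is_subfieldD(1)[OF F]]
  note m = min_poly_props[OF F x]
  obtain b where b: "b \<in> polys_over F" "poly b x * poly (pderiv (min_poly F x)) x = 1"
    by (rule inverse_poly_over[OF F x P(11)[OF m(1)] assms(3)])
  have "1 - pderiv (min_poly F x) * b \<in> polys_over F"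
    by (intro P b m)
  then obtain a where "1 - pderiv (min_poly F x) * b = min_poly F x * a"
    using min_poly_dvd[OF F x] b(2) by (metis diff_self mult.commute poly_1 poly_diff poly_mult)
  then show ?thesis
    using that[of a b] by (simp add: algebra_simps)
qed

text \<open>Removes the algebraic closure from the definition of separability. One direction
  evaluates at the image of \<open>x\<close>; in the other, the Bezout identity mapped through
  \<open>to_ac\<close> excludes every common root.\<close>

lemma separable_over_iff_min_poly:
  assumes F: "is_subfield F"
  shows "separable_over F x \<longleftrightarrow> algebraic_over F x \<and> poly (pderiv (min_poly F x)) x \<noteq> 0"
proof (cases "algebraic_over F x")
  case x: True
  note m = min_poly_props[OF F x]
  let ?m = "min_poly F x"
  have "map_poly to_ac ?m \<noteq> 0"
    using m(2) by (auto simp: map_poly_eq_0_iff)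
  then have iff: "separable_over F x \<longleftrightarrow>
      (\<forall>a. \<not> (poly (map_poly to_ac ?m) a = 0 \<and> poly (map_poly to_ac (pderiv ?m)) a = 0))"
    unfolding separable_over_def pderiv_map_to_ac[symmetric]
    using x rsquarefree_iff_no_common_root by blast
  show ?thesis
  proof
    assume "separable_over F x"
    then show "algebraic_over F x \<and> poly (pderiv ?m) x \<noteq> 0"
      using iff m(3) x poly_map_to_ac by (metis to_ac_0)
  next
    assume "algebraic_over F x \<and> poly (pderiv ?m) x \<noteq> 0"
    then obtain a b where "?m * a + pderiv ?m * b = 1"
      using min_poly_pderiv_bezout[OF F] by blast
    then have "map_poly to_ac ?m * map_poly to_ac a
        + map_poly to_ac (pderiv ?m) * map_poly to_ac b = map_poly to_ac 1"
      by (metis map_to_ac_add map_to_ac_mult)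
    then have "poly (map_poly to_ac ?m) y * poly (map_poly to_ac a) y
        + poly (map_poly to_ac (pderiv ?m)) y * poly (map_poly to_ac b) y = 1" for y
      by (metis map_poly_1' poly_1 poly_add poly_mult to_ac_1)
    then show "separable_over F x"
      unfolding iff by (metis add_0 mult_zero_left zero_neq_one)
  qed
qed (simp add: separable_over_def)

text \<open>Any annihilator with a simple root at \<open>x\<close> may serve as witness: if
  \<open>q = m * a\<close> with \<open>m\<close> minimal, then \<open>q'(x) = a(x) m'(x)\<close>. In
  this form separability visibly passes to larger base fields.\<close>

lemma separable_over_iff:
  assumes F: "is_subfield F"
  shows "separable_over F x \<longleftrightarrow> (\<exists>q\<in>polys_over F. poly q x = 0 \<and> poly (pderiv q) x \<noteq> 0)"
proof
  assume "separable_over F x"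
  then show "\<exists>q\<in>polys_over F. poly q x = 0 \<and> poly (pderiv q) x \<noteq> 0"
    using separable_over_iff_min_poly[OF F] min_poly_props[OF F] by blast
next
  assume "\<exists>q\<in>polys_over F. poly q x = 0 \<and> poly (pderiv q) x \<noteq> 0"
  then obtain q where q: "q \<in> polys_over F" "poly q x = 0" "poly (pderiv q) x \<noteq> 0"
    by blast
  then have x: "algebraic_over F x"
    unfolding algebraic_over_def by (intro bexI[of _ q]) auto
  obtain a where "q = min_poly F x * a"
    by (rule min_poly_dvd[OF F x q(1,2)])
  then have "poly (pderiv q) x = poly a x * poly (pderiv (min_poly F x)) x"
    using min_poly_props(3)[OF F x] by (simp add: pderiv_mult)
  then show "separable_over F x"
    using q(3) x separable_over_iff_min_poly[OF F] by auto
qed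

lemma separable_over_mono:
  assumes "is_subfield F" "is_subfield E" "F \<subseteq> E" "separable_over F x"
  shows "separable_over E x"
  using assms polys_over_mono[OF assms(3)] by (auto simp: separable_over_iff)

lemma separable_over_base:
  assumes "is_subfield F" "x \<in> F"
  shows "separable_over F x"
  unfolding separable_over_iff[OF assms(1)]
  using is_subringD[OF is_subfieldD(1)[OF assms(1)]] assms(2)
  by (intro bexI[of _ "[:-x, 1:]"])
    (auto simp: polys_over_pCons_iff pderiv_pCons polys_over_closed is_subfieldD(1)[OF assms(1)])

section \<open>Frobenius powers, and radical elements of separable extensions\<close>

lemma poly_power_CHAR_in_polys_over:
  fixes q :: "'a::field poly"
  assumes F: "is_subring F" and p: "prime CHAR('a)"
    and "\<And>i. coeff q i ^ CHAR('a) \<in> F"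
  shows "q ^ CHAR('a) \<in> polys_over F"
  using assms(3)
proof (induction q)
  case 0
  then show ?case
    using p prime_gt_0_nat[OF p] by (simp add: power_0_left polys_over_closed[OF F])
next
  case (pCons a q)
  note P = polys_over_closed[OF F]
  have "coeff q i ^ CHAR('a) \<in> F" for i
    using pCons.prems[of "Suc i"] by simp
  then have q: "q ^ CHAR('a) \<in> polys_over F"
    by (rule pCons.IH)
  \<comment> \<open>Splitting off the constant term lets additivity of the \<open>p\<close>-th power
    turn this into \<open>a^p + X^p q^p\<close>.\<close>
  have "pCons a q = [:a:] + monom 1 1 * q"
    by (simp add: monom_altdef)
  then have "pCons a q ^ CHAR('a) = [:a:] ^ CHAR('a) + (monom 1 1 * q) ^ CHAR('a)"
    using freshmans_dream[where ?'a = "'a poly"] p by simp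
  also have "\<dots> = [:a ^ CHAR('a):] + monom 1 CHAR('a) * q ^ CHAR('a)"
    by (simp add: power_mult_distrib monom_power poly_const_pow)
  also have "\<dots> \<in> polys_over F"
    using pCons.prems[of 0] by (intro P q is_subringD(2)[OF F]) auto
  finally show ?case .
qed

lemma poly_power_CHAR_in_subring:
  fixes z :: "'a::field"
  assumes F: "is_subring F" and p: "prime CHAR('a)" and z: "z ^ CHAR('a) \<in> F" and "q \<in> polys_over F"
  shows "poly q z ^ CHAR('a) \<in> F"
  using assms(4)
proof (induction q)
  case 0
  then show ?case
    using prime_gt_0_nat[OF p] is_subringD[OF F] by (simp add: power_0_left)
next
  case (pCons a q)
  have "poly (pCons a q) z ^ CHAR('a) = a ^ CHAR('a) + z ^ CHAR('a) * poly q z ^ CHAR('a)"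
    using freshmans_dream[where ?'a = 'a] p by (simp add: power_mult_distrib)
  then show ?case
    using pCons z by (auto simp: polys_over_pCons_iff intro!: is_subringD[OF F])
qed

text \<open>Let \<open>m\<close> and \<open>n\<close> be the minimal polynomials of \<open>x\<close> over \<open>F\<close> and over \<open>F(z)\<close>. Then \<open>n\<close> divides
  \<open>m\<close>, while \<open>m\<close> divides \<open>n\<^sup>p\<close>, whose coefficients lie in \<open>F\<close>. As \<open>m\<close> is squarefree, \<open>m = n\<close>, and so
  writing \<open>z\<close> as a reduced polynomial in \<open>x\<close> over \<open>F\<close> shows that this polynomial is constant.\<close>

lemma separable_adjoin_radical_step:
  fixes z x :: "'a::field"
  assumes F: "is_subfield F" and p: "prime CHAR('a)" and x: "separable_over F x"
    and z: "z \<in> adjoin F x" "z ^ CHAR('a) \<in> F"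
  shows "z \<in> F"
proof -
  note R = is_subfieldD(1)[OF F]
  have xF: "algebraic_over F x" and sep: "poly (pderiv (min_poly F x)) x \<noteq> 0"
    using x separable_over_iff_min_poly[OF F] by auto
  have "algebraic_over F z"
    using algebraic_over_power[OF R z(2)] prime_gt_0_nat[OF p] by simp
  define E where "E = adjoin F z"
  have E: "is_subfield E" and FE: "F \<subseteq> E" and zE: "z \<in> E"
    using is_subfield_adjoin[OF F \<open>algebraic_over F z\<close>] subset_adjoin[OF R] adjoin_self[OF R]
    by (auto simp: E_def)
  have xE: "algebraic_over E x"
    using algebraic_over_mono[OF FE xF] .
  define m where "m = min_poly F x"
  define n where "n = min_poly E x"
  note m = min_poly_props[OF F xF, folded m_def]
  note n = min_poly_props[OF E xE, folded n_def]
  have "m \<in> polys_over E"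
    using m(1) polys_over_mono[OF FE] by blast
  then obtain r where r: "m = n * r"
    using min_poly_dvd[OF E xE _ m(3)] unfolding n_def by blast
  have "coeff n i ^ CHAR('a) \<in> F" for i
  proof -
    have "coeff n i \<in> adjoin F z"
      using n(1) by (simp add: polys_over_def E_def)
    then show ?thesis
      using poly_power_CHAR_in_subring[OF R p z(2)] by (auto simp: adjoin_def)
  qed
  then have "n ^ CHAR('a) \<in> polys_over F"
    using poly_power_CHAR_in_polys_over[OF R p] by blast
  moreover have "poly (n ^ CHAR('a)) x = 0"
    using n(3) prime_gt_0_nat[OF p] by (simp add: power_0_left)
  ultimately obtain s where s: "n ^ CHAR('a) = m * s"
    using min_poly_dvd[OF F xF] unfolding m_def by blast
  obtain a b where ab: "m * a + pderiv m * b = 1"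
    using min_poly_pderiv_bezout[OF F xF sep] unfolding m_def by blast
  \<comment> \<open>Substituting \<open>m = n * r\<close> in the Bezout identity shows that
    \<open>n\<close> and \<open>r\<close> are coprime; this is the squarefreeness of
    \<open>m\<close> in usable form.\<close>
  have "n * (r * a + pderiv r * b) + r * (pderiv n * b) = 1"
    using ab by (simp add: r pderiv_mult algebra_simps)
  then obtain A B where AB: "n * A + r * B = 1"
    by blast
  \<comment> \<open>A factor coprime to \<open>n\<close> that divides a power of \<open>n\<close> is
    a unit: the powers are stripped one at a time.\<close>
  have "r dvd 1" if "r dvd n ^ j" for j
    using that
  proof (induction j)
    case (Suc j)
    have "n ^ j = n ^ Suc j * A + r * (n ^ j * B)"
      using arg_cong[OF AB, of "\<lambda>t. n ^ j * t"] by (simp add: algebra_simps)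
    then show ?case
      using Suc by (metis dvd_add dvd_mult2 dvd_triv_left)
  qed simp
  moreover have "r dvd n ^ CHAR('a)"
    using s r by simp
  ultimately have "is_unit r"
    by blast
  then obtain c where "r = [:c:]" "c \<noteq> 0"
    by (metis is_unit_poly_iff not_is_unit_0 pCons_0_0)
  then have deg: "Polynomial.degree m = Polynomial.degree n"
    using r by simp
  have m0: "Polynomial.degree m > 0"
    using m(2,3) by (metis degree_eq_zeroE gr0I lead_coeff_pCons(2) poly_const_conv zero_neq_one)
  obtain f0 where "f0 \<in> polys_over F" "z = poly f0 x"
    using z(1) by (auto simp: adjoin_def)
  then obtain f where f: "f \<in> polys_over F" "z = poly f x" "f = 0 \<or> Polynomial.degree f < Polynomial.degree m"
    using poly_mod_min_poly[OF F xF] unfolding m_def by metis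
  have "f - [:z:] \<in> polys_over E"
    using polys_over_mono[OF FE] f(1) zE by (intro polys_over_closed is_subfieldD(1)[OF E]) auto
  moreover have "poly (f - [:z:]) x = 0"
    using f(2) by simp
  moreover have "Polynomial.degree (f - [:z:]) < Polynomial.degree n"
    using f(3) m0 deg by (intro degree_diff_less) auto
  ultimately have "f - [:z:] = 0"
    using n(4) by fastforce
  then have "z = coeff f 0"
    by simp
  then show ?thesis
    using f(1) by (auto simp: polys_over_def)
qed

text \<open>Take the last iterated \<open>p\<close>-th power of \<open>z\<close> that is still
  outside \<open>F\<close>. The set \<open>F\<close> is arbitrary so that it can also be the set of
  separable elements, as in \<open>separable_over_if_in_adjoin2\<close>.\<close>

lemma radical_height_one:
  fixes z :: "'a::field"
  assumes L: "is_subring L" and z: "z \<in> L" "z \<notin> F" "z ^ (p ^ n) \<in> F"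
  obtains w where "w \<in> L" "w \<notin> F" "w ^ p \<in> F"
proof -
  define m where "m = (LEAST m. z ^ (p ^ m) \<in> F)"
  have m: "z ^ (p ^ m) \<in> F"
    unfolding m_def by (rule LeastI) (rule z(3))
  then obtain i where i: "m = Suc i"
    using z(2) by (cases m) auto
  show ?thesis
  proof
    show "z ^ (p ^ i) \<in> L"
      by (rule is_subringD(7)[OF L z(1)])
    show "z ^ (p ^ i) \<notin> F"
      using not_less_Least[of i "\<lambda>m. z ^ (p ^ m) \<in> F"] i m_def by simp
    show "(z ^ (p ^ i)) ^ p \<in> F"
      using m i by (simp add: power_mult[symmetric] mult.commute)
  qed
qed

lemma separable_adjoin_radical:
  fixes z x :: "'a::field"
  assumes "is_subfield F" "prime CHAR('a)" "separable_over F x" "z \<in> adjoin F x" "z ^ (CHAR('a) ^ n) \<in> F"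
  shows "z \<in> F"
proof (rule ccontr)
  assume "z \<notin> F"
  then obtain w where "w \<in> adjoin F x" "w \<notin> F" "w ^ CHAR('a) \<in> F"
    using radical_height_one[OF is_subring_adjoin[OF is_subfieldD(1)[OF assms(1)]] assms(4) _ assms(5)]
    by metis
  then show False
    using separable_adjoin_radical_step[OF assms(1-3)] by metis
qed

lemma separable_radical:
  fixes x :: "'a::field"
  assumes "is_subfield F" "prime CHAR('a)" "separable_over F x" "x ^ (CHAR('a) ^ n) \<in> F"
  shows "x \<in> F"
  using separable_adjoin_radical[OF assms(1-3) _ assms(4)] adjoin_self is_subfieldD(1)[OF assms(1)] by blast

text \<open>If \<open>w = h(w^p)\<close>, then \<open>h(X^p) - X\<close> vanishes at
  \<open>w\<close>, and its derivative is the constant \<open>-1\<close>.\<close>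

lemma separable_over_if_in_adjoin_power:
  fixes w :: "'a::field"
  assumes F: "is_subfield F" and p: "prime CHAR('a)" and w: "w \<in> adjoin F (w ^ CHAR('a))"
  shows "separable_over F w"
proof -
  note R = is_subfieldD(1)[OF F]
  obtain h where h: "h \<in> polys_over F" "w = poly h (w ^ CHAR('a))"
    using w by (auto simp: adjoin_def)
  define q where "q = pcompose h (monom 1 CHAR('a)) - [:0, 1:]"
  have "q \<in> polys_over F" 
    unfolding q_def using is_subringD[OF R]
    by (intro polys_over_closed[OF R] h) (auto simp: polys_over_pCons_iff polys_over_closed[OF R])
  moreover have "poly q w = 0"
    using h(2) by (simp add: q_def poly_pcompose poly_monom)
  moreover have "pderiv q = [:-1:]"
    by (simp add: q_def pderiv_diff pderiv_pcompose pderiv_monom pderiv_pCons one_pCons)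
  ultimately show ?thesis
    unfolding separable_over_iff[OF F] by (intro bexI[of _ q]) auto
qed

lemma coeff_pcompose_monom:
  fixes g :: "'a::comm_semiring_1 poly"
  assumes "k > 0"
  shows "coeff (pcompose g (monom 1 k)) i = (if k dvd i then coeff g (i div k) else 0)"
proof (induction g arbitrary: i)
  case (pCons a g)
  show ?case
  proof (cases "i < k")
    case True
    then show ?thesis
      using assms by (auto simp: pcompose_pCons coeff_monom_mult coeff_pCons split: nat.split)
  next
    case False
    then obtain j where j: "i = k + j"
      using le_Suc_ex not_less by blast
    then show ?thesis
      using assms pCons.IH[of j]
      by (auto simp: pcompose_pCons coeff_monom_mult coeff_pCons split: nat.split)
  qed
qed simp

text \<open>A vanishing derivative means \<open>i * coeff q i = 0\<close> for all positive
  \<open>i\<close>, so only exponents divisible by the characteristic survive; \<open>g\<close>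
  collects their coefficients.\<close>

lemma pcompose_monom_CHAR_of_pderiv_eq_0:
  fixes q :: "'a::field poly"
  assumes "CHAR('a) > 0" "pderiv q = 0"
  obtains g where "q = pcompose g (monom 1 CHAR('a))" "\<And>i. coeff g i = coeff q (i * CHAR('a))"
proof -
  define g where "g = Poly (map (\<lambda>i. coeff q (i * CHAR('a))) [0..<Suc (Polynomial.degree q)])"
  have g: "coeff g i = coeff q (i * CHAR('a))" for i
  proof (cases "i \<le> Polynomial.degree q")
    case False
    moreover from this have "Polynomial.degree q < i * CHAR('a)"
      using assms(1) by (metis One_nat_def Suc_leI less_le_trans mult.right_neutral mult_le_mono2 not_le)
    ultimately show ?thesis
      by (simp add: g_def nth_default_def coeff_eq_0 del: upt_Suc)
  qed (simp add: g_def nth_default_def del: upt_Suc)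
  have "coeff q i = 0" if ndvd: "\<not> CHAR('a) dvd i" for i
  proof -
    obtain j where j: "i = Suc j"
      using ndvd by (cases i) auto
    have "of_nat i * coeff q i = 0"
      using coeff_pderiv[of q j] assms(2) j by simp
    then show ?thesis
      using ndvd by (simp add: of_nat_eq_0_iff_char_dvd)
  qed
  then have "q = pcompose g (monom 1 CHAR('a))"
    using assms(1) by (intro poly_eqI) (auto simp: coeff_pcompose_monom g)
  then show ?thesis
    using g that by blast
qed

text \<open>Descent on the degree of an annihilator \<open>q\<close>. If its derivative is nonzero
  at \<open>z\<close>, then \<open>z\<close> is separable; if the derivative vanishes at
  \<open>z\<close> but not identically, it is a smaller annihilator; if it is zero, then
  \<open>q = g(X^p)\<close> and \<open>g\<close> annihilates \<open>z^p\<close>.\<close>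

lemma separable_over_power:
  fixes z :: "'a::field"
  assumes F: "is_subfield F" and p: "prime CHAR('a)" and "algebraic_over F z"
  obtains n where "separable_over F (z ^ (CHAR('a) ^ n))"
proof -
  note R = is_subfieldD(1)[OF F]
  have "\<exists>n. separable_over F (z ^ (CHAR('a) ^ n))"
    if "q \<in> polys_over F" "q \<noteq> 0" "poly q z = 0" for q z
    using that
  proof (induction "Polynomial.degree q" arbitrary: q z rule: less_induct)
    case less
    have deg: "Polynomial.degree q > 0"
      using less.prems by (metis degree_eq_zeroE gr0I pCons_0_0 poly_const_conv)
    consider "poly (pderiv q) z \<noteq> 0" | "poly (pderiv q) z = 0" "pderiv q \<noteq> 0" | "pderiv q = 0"
      by blast
    then show ?case
    proof cases
      case 1
      then have "separable_over F (z ^ CHAR('a) ^ 0)"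
        using less.prems separable_over_iff[OF F] by auto
      then show ?thesis ..
    next
      case 2
      have "Polynomial.degree (pderiv q) < Polynomial.degree q"
      proof -
        have "Polynomial.degree (pderiv q) \<le> Polynomial.degree q - 1"
          by (rule degree_le) (auto simp: coeff_pderiv coeff_eq_0)
        then show ?thesis
          using deg by linarith
      qed
      then show ?thesis
        using less.hyps[OF _ polys_over_closed(11)[OF R less.prems(1)] 2(2,1)] by blast
    next
      case 3
      obtain g where g: "q = pcompose g (monom 1 CHAR('a))" "\<And>i. coeff g i = coeff q (i * CHAR('a))"
        using pcompose_monom_CHAR_of_pderiv_eq_0[OF prime_gt_0_nat[OF p] 3] by blast
      have "g \<in> polys_over F" "g \<noteq> 0" "poly g (z ^ CHAR('a)) = 0"
        using less.prems g by (auto simp: polys_over_def poly_pcompose poly_monom)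
      moreover have "Polynomial.degree g < Polynomial.degree q"
        using deg prime_gt_1_nat[OF p] unfolding g(1) by (simp add: degree_pcompose degree_monom_eq)
      ultimately obtain n where "separable_over F ((z ^ CHAR('a)) ^ CHAR('a) ^ n)"
        using less.hyps by blast
      then have "separable_over F (z ^ CHAR('a) ^ Suc n)"
        by (simp add: power_mult)
      then show ?thesis ..
    qed
  qed
  then show ?thesis
    using assms(3) that unfolding algebraic_over_def by blast
qed

text \<open>If \<open>z\<close> were inseparable, some power \<open>w\<close> of it would be
  inseparable with \<open>w^p\<close> separable. Over \<open>E = F(w^p)\<close> the element
  \<open>w\<close> is radical and lies in \<open>E(x)(y)\<close>; removing \<open>y\<close> and then
  \<open>x\<close> by \<open>separable_adjoin_radical_step\<close> puts \<open>w\<close> in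
  \<open>E\<close>, so \<open>w\<close> is separable after all.\<close>

lemma separable_over_if_in_adjoin2:
  fixes x y z :: "'a::field"
  assumes F: "is_subfield F" and p: "prime CHAR('a)"
    and x: "separable_over F x" and y: "separable_over F y"
    and z: "algebraic_over F z" "z \<in> adjoin (adjoin F x) y"
  shows "separable_over F z"
proof -
  note R = is_subfieldD(1)[OF F]
  have step: "separable_over F w"
    if w: "w \<in> adjoin (adjoin F x) y" "separable_over F (w ^ CHAR('a))" for w
  proof -
    define E where "E = adjoin F (w ^ CHAR('a))"
    have E: "is_subfield E" and FE: "F \<subseteq> E" and wE: "w ^ CHAR('a) \<in> E"
      using is_subfield_adjoin[OF F] w(2) subset_adjoin[OF R] adjoin_self[OF R]
      by (auto simp: E_def separable_over_def)
    note RE = is_subfieldD(1)[OF E]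
    have x': "separable_over E x" and y': "separable_over E y"
      using separable_over_mono[OF F E FE] x y by auto
    define L where "L = adjoin E x"
    have L: "is_subfield L" and EL: "E \<subseteq> L" and xL: "x \<in> L"
      using is_subfield_adjoin[OF E] x' subset_adjoin[OF RE] adjoin_self[OF RE]
      by (auto simp: L_def separable_over_def)
    note RL = is_subfieldD(1)[OF L]
    have "adjoin F x \<subseteq> L"
      using adjoin_least[OF RL _ xL] FE EL by blast
    then have "adjoin (adjoin F x) y \<subseteq> adjoin L y"
      using adjoin_least[OF is_subring_adjoin[OF RL]] subset_adjoin[OF RL] adjoin_self[OF RL] by blast
    then have "w \<in> L"
      using separable_adjoin_radical_step[OF L p separable_over_mono[OF E L EL y']] w(1) wE EL by blast
    then have "w \<in> E"
      using separable_adjoin_radical_step[OF E p x'] wE unfolding L_def by blast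
    then show ?thesis
      using separable_over_if_in_adjoin_power[OF F p] unfolding E_def by blast
  qed
  obtain n where n: "separable_over F (z ^ (CHAR('a) ^ n))"
    by (rule separable_over_power[OF F p z(1)])
  show ?thesis
  proof (rule ccontr)
    assume "\<not> separable_over F z"
    then obtain w where "w \<in> adjoin (adjoin F x) y" "\<not> separable_over F w"
      "separable_over F (w ^ CHAR('a))"
      using radical_height_one[OF is_subring_adjoin[OF is_subring_adjoin[OF R]] z(2),
          of "{w. separable_over F w}"] n by (metis mem_Collect_eq)
    then show False
      using step by metis
  qed
qed

lemma is_subring_separable:
  fixes F R :: "'a::field set"
  assumes F: "is_subfield F" and p: "prime CHAR('a)"
    and R: "is_subring R" "F \<subseteq> R" "\<And>x. x \<in> R \<Longrightarrow> algebraic_over F x"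
  shows "is_subring {x \<in> R. separable_over F x}"
proof -
  note RF = is_subfieldD(1)[OF F]
  have "x + y \<in> adjoin (adjoin F x) y \<and> x * y \<in> adjoin (adjoin F x) y \<and> - x \<in> adjoin (adjoin F x) y" for x y
  proof -
    note A = is_subring_adjoin[OF RF, of x]
    note D = is_subringD[OF is_subring_adjoin[OF A, of y]]
    have "x \<in> adjoin (adjoin F x) y" "y \<in> adjoin (adjoin F x) y"
      using adjoin_self[OF RF] subset_adjoin[OF A] adjoin_self[OF A] by blast+
    then show ?thesis
      using D by blast
  qed
  then have mem: "x + y \<in> adjoin (adjoin F x) y" "x * y \<in> adjoin (adjoin F x) y"
    "- x \<in> adjoin (adjoin F x) y" for x y
    by auto
  note closed = is_subringD[OF R(1)]
  have sep: "separable_over F (x + y)" "separable_over F (x * y)" "separable_over F (- x)"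
    if "x \<in> R" "y \<in> R" "separable_over F x" "separable_over F y" for x y
    using separable_over_if_in_adjoin2[OF F p that(3,4) R(3) mem(1)]
      separable_over_if_in_adjoin2[OF F p that(3,4) R(3) mem(2)]
      separable_over_if_in_adjoin2[OF F p that(3,4) R(3) mem(3)]
      closed(3,4)[OF that(1,2)] closed(5)[OF that(1)] by simp_all
  have "separable_over F 0" "separable_over F 1"
    using separable_over_base[OF F] is_subringD[OF RF] by simp_all
  then show ?thesis
    unfolding is_subring_def using sep closed by simp
qed

section \<open>Radicial elements of height one\<close>

text \<open>Were the degree \<open>Suc d\<close> of the minimal polynomial below \<open>p\<close>,
  its derivative would have a nonzero coefficient at \<open>d\<close>, hence be nonzero at
  \<open>u\<close> by minimality. Then \<open>u\<close> would be both separable and radical, so in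
  \<open>F\<close>.\<close>

lemma radical_root_degree:
  fixes u :: "'a::field"
  assumes F: "is_subfield F" and p: "prime CHAR('a)" and u: "u ^ CHAR('a) \<in> F" "u \<notin> F"
    and Q: "Q \<in> polys_over F" "poly Q u = 0" "Polynomial.degree Q < CHAR('a)"
  shows "Q = 0"
proof (rule ccontr)
  assume "Q \<noteq> 0"
  have alg: "algebraic_over F u"
    using algebraic_over_power[OF is_subfieldD(1)[OF F] u(1)] prime_gt_0_nat[OF p] by simp
  define m where "m = min_poly F u"
  note m = min_poly_props[OF F alg, folded m_def]
  have "Polynomial.degree m > 0"
    using m(2,3) by (metis degree_eq_zeroE gr0I lead_coeff_pCons(2) poly_const_conv zero_neq_one)
  then obtain d where d: "Polynomial.degree m = Suc d"
    using gr0_implies_Suc by blast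
  have "Suc d < CHAR('a)"
    using m(4)[OF Q(1) \<open>Q \<noteq> 0\<close> Q(2)] Q(3) d by simp
  then have "coeff (pderiv m) d \<noteq> 0"
    using m(2) d by (auto simp: coeff_pderiv of_nat_eq_0_iff_char_dvd simp del: of_nat_Suc dest: dvd_imp_le)
  then have "pderiv m \<noteq> 0"
    by auto
  have "Polynomial.degree (pderiv m) \<le> d"
    by (rule degree_le) (auto simp: coeff_pderiv coeff_eq_0 d)
  then have "poly (pderiv m) u \<noteq> 0"
    using m(4)[OF polys_over_closed(11)[OF is_subfieldD(1)[OF F] m(1)] \<open>pderiv m \<noteq> 0\<close>] d by auto
  then have "separable_over F u"
    using separable_over_iff[OF F] m(1,3) by blast
  then show False
    using separable_radical[OF F p, of u 1] u by simp
qed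

text \<open>Reduce modulo the monic polynomial \<open>X^p - u^p\<close>, which works over any
  subring \<open>F\<close>.\<close>

lemma adjoin_radical_reduced:
  fixes u :: "'a::field"
  assumes F: "is_subring F" and p: "prime CHAR('a)" and u: "u ^ CHAR('a) \<in> F" and z: "z \<in> adjoin F u"
  obtains f where "f \<in> polys_over F" "z = poly f u" "Polynomial.degree f < CHAR('a)"
proof -
  define m where "m = monom 1 CHAR('a) - [:u ^ CHAR('a):]"
  have p0: "CHAR('a) > 0"
    using prime_gt_0_nat[OF p] .
  have "m \<in> polys_over F"
    unfolding m_def by (intro polys_over_closed[OF F] is_subringD(2)[OF F] u)
  moreover have deg: "Polynomial.degree m = CHAR('a)"
  proof (rule antisym)
    show "Polynomial.degree m \<le> CHAR('a)"
      unfolding m_def by (intro degree_diff_le) (auto simp: degree_monom_eq)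
    show "CHAR('a) \<le> Polynomial.degree m"
      using p0 by (intro le_degree) (auto simp: m_def coeff_pCons split: nat.split)
  qed
  moreover have "Polynomial.lead_coeff m = 1"
    using p0 unfolding deg by (auto simp: m_def coeff_pCons split: nat.split)
  moreover obtain q where q: "q \<in> polys_over F" "z = poly q u"
    using z by (auto simp: adjoin_def)
  ultimately obtain a r where r: "r \<in> polys_over F" "q = m * a + r"
    "r = 0 \<or> Polynomial.degree r < Polynomial.degree m"
    using polys_over_division[OF F] by metis
  have "poly m u = 0"
    by (simp add: m_def poly_monom)
  then show ?thesis
    using r q(2) deg p0 by (intro that[of r]) auto
qed

text \<open>With \<open>z = f(x)\<close> and \<open>f\<close> of degree below \<open>p\<close>, the
  polynomial \<open>f - z\<close> over \<open>F(z)\<close> vanishes at \<open>x\<close>. If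
  \<open>x\<close> were outside \<open>F(z)\<close>, it would be zero by
  \<open>radical_root_degree\<close>, making \<open>z\<close> a coefficient of \<open>f\<close> and
  so an element of \<open>F\<close>.\<close>

lemma adjoin_radical_exchange:
  fixes x :: "'a::field"
  assumes F: "is_subfield F" and p: "prime CHAR('a)" and x: "x ^ CHAR('a) \<in> F"
    and z: "z \<in> adjoin F x" "z \<notin> F"
  shows "x \<in> adjoin F z"
proof (rule ccontr)
  assume nx: "x \<notin> adjoin F z"
  note R = is_subfieldD(1)[OF F]
  obtain f where f: "f \<in> polys_over F" "z = poly f x" "Polynomial.degree f < CHAR('a)"
    by (rule adjoin_radical_reduced[OF R p x z(1)])
  have "z ^ CHAR('a) \<in> F"
    using poly_power_CHAR_in_subring[OF R p x f(1)] f(2) by simp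
  then have E: "is_subfield (adjoin F z)"
    using is_subfield_adjoin[OF F] algebraic_over_power[OF R] prime_gt_0_nat[OF p] by blast
  have "f - [:z:] \<in> polys_over (adjoin F z)"
    using f(1) polys_over_mono[OF subset_adjoin[OF R]] adjoin_self[OF R]
    by (intro polys_over_closed[OF is_subfieldD(1)[OF E]]) auto
  moreover have "Polynomial.degree (f - [:z:]) < CHAR('a)"
    using f(3) by (intro degree_diff_less) auto
  moreover have "poly (f - [:z:]) x = 0"
    using f(2) by simp
  moreover have "x ^ CHAR('a) \<in> adjoin F z"
    using x subset_adjoin[OF R] by blast
  ultimately have "f - [:z:] = 0"
    using radical_root_degree[OF E p _ nx] by blast
  then have "z = coeff f 0"
    by simp
  then show False
    using f(1) z(2) by (auto simp: polys_over_def)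
qed

text \<open>Linear disjointness is symmetric, so it suffices that the powers of \<open>u\<close> below \<open>p\<close> are
  independent over \<open>T\<close>.\<close>

lemma linearly_disjoint_adjoin_radical:
  fixes u :: "'a::field"
  assumes k: "is_subring k" and T: "is_subfield T" and kT: "k \<subseteq> T" and p: "prime CHAR('a)"
    and u: "u ^ CHAR('a) \<in> k" "u \<notin> T"
  shows "linearly_disjoint k T (adjoin k u)"
  unfolding linearly_disjoint_def
proof (intro allI impI)
  fix B assume B: "B \<subseteq> T" "lin_indep_over k B"
  show "lin_indep_over (adjoin k u) B"
    unfolding lin_indep_over_def
  proof (intro allI impI)
    fix A c assume "finite A \<and> A \<subseteq> B \<and> (\<forall>b\<in>A. c b \<in> adjoin k u) \<and> (\<Sum>b\<in>A. c b * b) = 0"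
    then have A: "finite A" "A \<subseteq> B" and c: "\<And>b. b \<in> A \<Longrightarrow> c b \<in> adjoin k u"
      and sum: "(\<Sum>b\<in>A. c b * b) = 0"
      by auto
    have "\<forall>b\<in>A. \<exists>f\<in>polys_over k. c b = poly f u \<and> Polynomial.degree f < CHAR('a)"
      using adjoin_radical_reduced[OF k p u(1)] c by metis
    then obtain f where f: "\<And>b. b \<in> A \<Longrightarrow> f b \<in> polys_over k" "\<And>b. b \<in> A \<Longrightarrow> c b = poly (f b) u"
      "\<And>b. b \<in> A \<Longrightarrow> Polynomial.degree (f b) < CHAR('a)"
      by metis
    \<comment> \<open>The relation over \<open>k[u]\<close> is read as a single polynomial over
      \<open>T\<close>, of degree below \<open>p\<close> and vanishing at \<open>u\<close>.\<close>
    define Q where "Q = (\<Sum>b\<in>A. smult b (f b))"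
    note RT = is_subfieldD(1)[OF T]
    have "coeff Q i \<in> T" for i
      unfolding Q_def coeff_sum using f(1) A(2) B(1) kT
      by (intro is_subring_sum[OF RT]) (auto simp: polys_over_def intro!: is_subringD[OF RT])
    then have "Q \<in> polys_over T"
      by (simp add: polys_over_def)
    moreover have "poly Q u = 0"
    proof -
      have "poly Q u = (\<Sum>b\<in>A. c b * b)"
        unfolding Q_def poly_sum by (intro sum.cong) (auto simp: f(2))
      then show ?thesis
        using sum by simp
    qed
    moreover have "Polynomial.degree Q < CHAR('a)"
      unfolding Q_def using f(3) prime_gt_0_nat[OF p]
      by (intro degree_sum_less) (auto intro: le_less_trans[OF degree_smult_le])
    ultimately have "Q = 0"
      using radical_root_degree[OF T p _ u(2)] u(1) kT by blast
    \<comment> \<open>Each coefficient of \<open>Q = 0\<close> is a relation between elements of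
      \<open>B\<close> with scalars in \<open>k\<close>.\<close>
    have "coeff (f b) i = 0" if "b \<in> A" for b i
    proof -
      have "(\<Sum>b\<in>A. coeff (f b) i * b) = coeff Q i"
        by (simp add: Q_def coeff_sum mult.commute)
      then have "(\<Sum>b\<in>A. coeff (f b) i * b) = 0"
        using \<open>Q = 0\<close> by simp
      moreover have "\<forall>b\<in>A. coeff (f b) i \<in> k"
        using f(1) by (auto simp: polys_over_def)
      ultimately show ?thesis
        using B(2) A that unfolding lin_indep_over_def by (meson)
    qed
    then have "f b = 0" if "b \<in> A" for b
      using that by (simp add: poly_eq_iff)
    then show "\<forall>b\<in>A. c b = 0"
      using f(2) by simp
  qed
qed

section \<open>Lattices of subalgebras\<close>

lemma is_subring_compositum: "is_subring (compositum V W)"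
  unfolding is_subring_def compositum_def by (auto intro: is_subringD)

lemma compositum_upper: "V \<subseteq> compositum V W" "W \<subseteq> compositum V W"
  unfolding compositum_def by auto

lemma compositum_least: "is_subring A \<Longrightarrow> V \<subseteq> A \<Longrightarrow> W \<subseteq> A \<Longrightarrow> compositum V W \<subseteq> A"
  unfolding compositum_def by auto

lemma compositum_absorb2: "is_subring W \<Longrightarrow> V \<subseteq> W \<Longrightarrow> compositum V W = W"
  by (simp add: compositum_least compositum_upper subset_antisym)

lemma compositum_absorb1: "is_subring V \<Longrightarrow> W \<subseteq> V \<Longrightarrow> compositum V W = V"
  by (simp add: compositum_least compositum_upper subset_antisym)

lemma compositum_mono: "V \<subseteq> V' \<Longrightarrow> W \<subseteq> W' \<Longrightarrow> compositum V W \<subseteq> compositum V' W'"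
  unfolding compositum_def by (rule Inter_anti_mono) auto

lemma compositum_in_subalgs:
  assumes "V \<in> subalgs R S" "W \<in> subalgs R S" "is_subring S"
  shows "compositum V W \<in> subalgs R S"
  using assms is_subring_compositum compositum_upper[of V W] compositum_least[of S V W]
  unfolding subalgs_def by blast

lemma Int_in_subalgs: "V \<in> subalgs R S \<Longrightarrow> W \<in> subalgs R S \<Longrightarrow> V \<inter> W \<in> subalgs R S"
  unfolding subalgs_def by (auto intro: is_subring_Int)

lemma boolean_ext_distrib:
  "boolean_ext R S \<Longrightarrow> A \<in> subalgs R S \<Longrightarrow> B \<in> subalgs R S \<Longrightarrow> C \<in> subalgs R S \<Longrightarrow>
    A \<inter> compositum B C = compositum (A \<inter> B) (A \<inter> C)"
  unfolding boolean_ext_def by blast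

lemma boolean_ext_complement:
  assumes "boolean_ext R S" "V \<in> subalgs R S"
  obtains V' where "V' \<in> subalgs R S" "V \<inter> V' = R" "compositum V V' = S"
proof -
  have "\<forall>V\<in>subalgs R S. \<exists>V'. is_complement R S V V'"
    using assms(1) unfolding boolean_ext_def by (rule conjunct2)
  then obtain V' where "is_complement R S V V'"
    using assms(2) by blast
  then show ?thesis
    using that unfolding is_complement_def by blast
qed

text \<open>Inside \<open>M\<close>, the trace \<open>M \<inter> V'\<close> of a complement
  \<open>V'\<close> is a complement, by distributivity.\<close>

lemma boolean_ext_lower:
  assumes B: "boolean_ext R S" and M: "M \<in> subalgs R S"
  shows "boolean_ext R M"
proof -
  have sub: "V \<in> subalgs R S" if "V \<in> subalgs R M" for V
    using that M by (auto simp: subalgs_def)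
  have "\<exists>V'. is_complement R M V V'" if V: "V \<in> subalgs R M" for V
  proof -
    obtain V' where V': "V' \<in> subalgs R S" "V \<inter> V' = R" "compositum V V' = S"
      by (rule boolean_ext_complement[OF B sub[OF V]])
    have "M \<inter> V' \<in> subalgs R M"
      using Int_in_subalgs[OF M V'(1)] by (auto simp: subalgs_def)
    moreover have "V \<inter> (M \<inter> V') = R"
      using V V'(2) by (auto simp: subalgs_def)
    moreover have "compositum V (M \<inter> V') = M"
    proof -
      have "compositum V (M \<inter> V') = compositum (M \<inter> V) (M \<inter> V')"
        using V by (simp add: subalgs_def inf.absorb2)
      also have "\<dots> = M \<inter> compositum V V'"
        using boolean_ext_distrib[OF B M sub[OF V] V'(1)] by simp
      also have "\<dots> = M"
        using V'(3) M by (auto simp: subalgs_def)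
      finally show ?thesis .
    qed
    ultimately show ?thesis
      using V unfolding is_complement_def by blast
  qed
  then show ?thesis
    unfolding boolean_ext_def using boolean_ext_distrib[OF B] sub by blast
qed

text \<open>Dually to \<open>boolean_ext_lower\<close>, a complement above \<open>M\<close> is the
  compositum of \<open>V'\<close> and \<open>M\<close>.\<close>

lemma boolean_ext_upper:
  assumes B: "boolean_ext R S" and S: "is_subring S" and M: "M \<in> subalgs R S"
  shows "boolean_ext M S"
proof -
  have sub: "V \<in> subalgs R S" if "V \<in> subalgs M S" for V
    using that M by (auto simp: subalgs_def)
  have "\<exists>V'. is_complement M S V V'" if V: "V \<in> subalgs M S" for V
  proof -
    obtain V' where V': "V' \<in> subalgs R S" "V \<inter> V' = R" "compositum V V' = S"
      by (rule boolean_ext_complement[OF B sub[OF V]])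
    have "compositum V' M \<in> subalgs M S"
      using compositum_in_subalgs[OF V'(1) M S] compositum_upper[of M V'] compositum_upper(2)[of M V']
      by (auto simp: subalgs_def intro: compositum_upper[THEN subsetD])
    moreover have "V \<inter> compositum V' M = M"
    proof -
      have "V \<inter> compositum V' M = compositum R (V \<inter> M)"
        using boolean_ext_distrib[OF B sub[OF V] V'(1) M] V'(2) by simp
      also have "\<dots> = M"
        using V M compositum_absorb2[of M R] by (simp add: subalgs_def inf.absorb2)
      finally show ?thesis .
    qed
    moreover have "compositum V (compositum V' M) = S"
    proof
      show "compositum V (compositum V' M) \<subseteq> S"
        using V V'(1) M S by (intro compositum_least) (auto simp: subalgs_def)
      show "S \<subseteq> compositum V (compositum V' M)"
        using compositum_mono[of V V V' "compositum V' M"] V'(3) compositum_upper(1) by blast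
    qed
    ultimately show ?thesis
      using V unfolding is_complement_def by blast
  qed
  then show ?thesis
    unfolding boolean_ext_def using boolean_ext_distrib[OF B] sub by blast
qed

text \<open>Nontrivial complements would contain elements \<open>x\<close>, \<open>y\<close> of height one. By the exchange
  property the algebra generated by \<open>x + y\<close> meets those generated by \<open>x\<close> and by \<open>y\<close> trivially,
  which contradicts distributivity.\<close>

lemma minimal_ext_if_boolean_radical:
  fixes R S :: "'a::field set"
  assumes R: "is_subfield R" and S: "is_subring S" "R \<subset> S" and p: "prime CHAR('a)"
    and rad: "\<And>x. x \<in> S \<Longrightarrow> \<exists>n. x ^ (CHAR('a) ^ n) \<in> R" and B: "boolean_ext R S"
  shows "minimal_ext R S"
proof -
  note SR = is_subfieldD(1)[OF R]
  have height_one: "\<exists>x\<in>L. x \<notin> R \<and> x ^ CHAR('a) \<in> R" if L: "L \<in> subalgs R S" "L \<noteq> R" for L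
  proof -
    obtain z where z: "z \<in> L" "z \<notin> R" "z \<in> S"
      using L by (auto simp: subalgs_def)
    obtain n where n: "z ^ (CHAR('a) ^ n) \<in> R"
      using rad[OF z(3)] by blast
    have "is_subring L"
      using L by (simp add: subalgs_def)
    from radical_height_one[OF this z(1,2) n] show ?thesis
      by metis
  qed
  have "L = R \<or> L = S" if L: "L \<in> subalgs R S" for L
  proof (rule ccontr)
    assume ne: "\<not> (L = R \<or> L = S)"
    obtain L' where L': "L' \<in> subalgs R S" "L \<inter> L' = R" "compositum L L' = S"
      by (rule boolean_ext_complement[OF B L])
    have "L' \<noteq> R"
      using L L'(3) ne compositum_absorb1[of L R] by (auto simp: subalgs_def)
    obtain x where x: "x \<in> L" "x \<notin> R" "x ^ CHAR('a) \<in> R"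
      using height_one[OF L] ne by blast
    obtain y where y: "y \<in> L'" "y \<notin> R" "y ^ CHAR('a) \<in> R"
      using height_one[OF L'(1) \<open>L' \<noteq> R\<close>] by blast
    have LS: "is_subring L" "R \<subseteq> L" "L \<subseteq> S" "is_subring L'" "R \<subseteq> L'" "L' \<subseteq> S"
      using L L'(1) by (auto simp: subalgs_def)
    have xL: "adjoin R x \<subseteq> L" and yL: "adjoin R y \<subseteq> L'"
      using adjoin_least LS x(1) y(1) by blast+
    have yx: "y \<notin> adjoin R x" and xy: "x \<notin> adjoin R y"
      using xL yL x y L'(2) by blast+
    have cross: "adjoin R (a + b) \<inter> adjoin R a = R"
      if ab: "a ^ CHAR('a) \<in> R" "b ^ CHAR('a) \<in> R" "b \<notin> adjoin R a" for a b :: 'a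
    proof (rule ccontr)
      assume "adjoin R (a + b) \<inter> adjoin R a \<noteq> R"
      then obtain z where z: "z \<in> adjoin R (a + b)" "z \<in> adjoin R a" "z \<notin> R"
        using subset_adjoin[OF SR] by blast
      have "(a + b) ^ CHAR('a) \<in> R"
        using ab(1,2) freshmans_dream[where ?'a = 'a] p is_subringD(3)[OF SR] by simp
      then have "a + b \<in> adjoin R z"
        using adjoin_radical_exchange[OF R p _ z(1,3)] by blast
      then have "a + b \<in> adjoin R a"
        using adjoin_least[OF is_subring_adjoin[OF SR] subset_adjoin[OF SR] z(2)] by blast
      then have "(a + b) - a \<in> adjoin R a"
        using is_subringD(6)[OF is_subring_adjoin[OF SR]] adjoin_self[OF SR] by blast
      then show False
        using ab(3) by simp
    qed
    let ?A = "adjoin R (x + y)" and ?C = "compositum (adjoin R x) (adjoin R y)"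
    have "x + y \<in> S"
      using x(1) y(1) LS is_subringD(3)[OF S(1)] by blast
    moreover have "x \<in> S" "y \<in> S"
      using x(1) y(1) LS by blast+
    moreover have "adjoin R w \<in> subalgs R S" if "w \<in> S" for w
      using adjoin_least[OF S(1) _ that, of R] S(2) is_subring_adjoin[OF SR] subset_adjoin[OF SR]
      by (simp add: subalgs_def psubset_imp_subset)
    ultimately have in_subalgs:
      "?A \<in> subalgs R S" "adjoin R x \<in> subalgs R S" "adjoin R y \<in> subalgs R S"
      by blast+
    have "x \<in> ?C" "y \<in> ?C"
      using compositum_upper adjoin_self[OF SR] by blast+
    then have "x + y \<in> ?C"
      using is_subringD(3)[OF is_subring_compositum] by blast
    then have "x + y \<in> ?A \<inter> ?C"
      using adjoin_self[OF SR] by blast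
    also have "\<dots> = compositum (?A \<inter> adjoin R x) (?A \<inter> adjoin R y)"
      by (rule boolean_ext_distrib[OF B in_subalgs])
    also have "\<dots> = R"
      using cross[OF x(3) y(3) yx] cross[OF y(3) x(3) xy] compositum_absorb1[OF SR order.refl]
      by (simp add: add.commute)
    \<comment> \<open>Distributivity has forced \<open>x + y\<close> into \<open>R\<close>, which
      drags \<open>y\<close> into \<open>L \<inter> L' = R\<close>.\<close>
    finally have "(x + y) - x \<in> L"
      using LS x(1) is_subringD(6)[OF LS(1)] by blast
    then have "y \<in> L \<inter> L'"
      using y(1) by simp
    then show False
      using L'(2) y(2) by simp
  qed
  moreover have "R \<in> subalgs R S" "S \<in> subalgs R S"
    using S SR by (auto simp: subalgs_def)
  ultimately show ?thesis
    using S(2) unfolding minimal_ext_def by blast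
qed

section \<open>Separable and radicial closures\<close>

text \<open>By finiteness two of the algebras \<open>k[x^(2^i)]\<close> coincide, which expresses
  \<open>x^(2^i)\<close> as \<open>g(x^(2^j))\<close> with \<open>i < j\<close>. As
  \<open>2^j\<close> does not divide \<open>2^i\<close>, the resulting relation has coefficient
  \<open>-1\<close> at \<open>2^i\<close> and is not trivial.\<close>

lemma algebraic_over_if_FIP:
  assumes k: "is_subring k" and K: "is_subring K" "k \<subseteq> K" and fin: "FIP k K" and x: "x \<in> K"
  shows "algebraic_over k x"
proof -
  define f where "f i = adjoin k (x ^ (2 ^ i))" for i :: nat
  have "f i \<in> subalgs k K" for i
    using is_subring_adjoin[OF k] subset_adjoin[OF k] adjoin_least[OF K(1,2)] is_subringD(7)[OF K(1) x]
    by (auto simp: f_def subalgs_def)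
  then have "finite (range f)"
    using fin unfolding FIP_def by (meson finite_subset image_subsetI)
  then have "\<not> inj f"
    using finite_imageD infinite_UNIV_nat by blast
  then obtain i j where ij: "i < j" "f i = f j"
    unfolding inj_def by (metis linorder_neqE_nat)
  have "x ^ (2 ^ i) \<in> f j"
    using adjoin_self[OF k] ij(2) by (metis f_def)
  then obtain g where g: "g \<in> polys_over k" "x ^ (2 ^ i) = poly g (x ^ (2 ^ j))"
    by (auto simp: f_def adjoin_def)
  define q where "q = pcompose g (monom 1 (2 ^ j)) - monom 1 (2 ^ i)"
  have "q \<in> polys_over k"
    unfolding q_def by (intro polys_over_closed[OF k] g is_subringD[OF k])
  moreover have "poly q x = 0"
    using g(2) by (simp add: q_def poly_pcompose poly_monom)
  moreover have "\<not> (2 :: nat) ^ j dvd 2 ^ i"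
    using ij(1) by (auto dest!: dvd_imp_le)
  then have "coeff q (2 ^ i) = -1"
    by (simp add: q_def coeff_pcompose_monom)
  then have "q \<noteq> 0"
    by auto
  ultimately show ?thesis
    unfolding algebraic_over_def by blast
qed

text \<open>Powers of the characteristic exponent are additive, trivially so in characteristic
  \<open>0\<close>, and two elements have a common exponent that takes both into
  \<open>k\<close>.\<close>

lemma is_subring_radicial_closure:
  fixes k K :: "'a::field set"
  assumes k: "is_subring k" "is_subring K" "k \<subseteq> K"
  shows "is_subring (radicial_closure k K)"
proof -
  let ?p = "max 1 CHAR('a)"
  have add: "(x + y) ^ (?p ^ n) = x ^ (?p ^ n) + y ^ (?p ^ n)" for x y :: 'a and n
  proof (cases "CHAR('a) = 0")
    case False
    then have "prime CHAR('a)"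
      using prime_CHAR_semidom[where ?'a = 'a] by simp
    then show ?thesis
      using freshmans_dream'[where ?'a = 'a, of "?p ^ n" n] False by (simp add: max_def)
  qed simp
  have common: "\<exists>n. x ^ (?p ^ n) \<in> k \<and> y ^ (?p ^ n) \<in> k"
    if xy: "purely_inseparable_over k x" "purely_inseparable_over k y" for x y
  proof -
    obtain m n where mn: "x ^ (?p ^ m) \<in> k" "y ^ (?p ^ n) \<in> k"
      using xy unfolding purely_inseparable_over_def by blast
    have "x ^ (?p ^ (m + n)) = (x ^ (?p ^ m)) ^ (?p ^ n)" "y ^ (?p ^ (m + n)) = (y ^ (?p ^ n)) ^ (?p ^ m)"
      by (simp_all add: power_add mult.commute flip: power_mult)
    then show ?thesis
      using mn is_subringD(7)[OF k(1)] by metis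
  qed
  have base: "purely_inseparable_over k x" if "x \<in> k" for x
    unfolding purely_inseparable_over_def using that by (intro exI[of _ 0]) simp
  have add': "purely_inseparable_over k (x + y)" and mult: "purely_inseparable_over k (x * y)"
    if xy: "purely_inseparable_over k x" "purely_inseparable_over k y" for x y
  proof -
    obtain n where "x ^ (?p ^ n) \<in> k" "y ^ (?p ^ n) \<in> k"
      using common[OF xy] by blast
    then have "(x + y) ^ (?p ^ n) \<in> k" "(x * y) ^ (?p ^ n) \<in> k"
      unfolding add power_mult_distrib using is_subringD[OF k(1)] by blast+
    then show "purely_inseparable_over k (x + y)" "purely_inseparable_over k (x * y)"
      unfolding purely_inseparable_over_def by blast+
  qed
  have "purely_inseparable_over k (- x)" if "purely_inseparable_over k x" for x
    using mult[OF base that, of "- 1"] is_subringD[OF k(1)] by simp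
  then show ?thesis
    unfolding is_subring_def radicial_closure_def
    using add' mult base is_subringD[OF k(1)] is_subringD[OF k(2)] by auto
qed

lemma subset_radicial_closure:
  fixes k K :: "'a::field set"
  assumes "k \<subseteq> K"
  shows "k \<subseteq> radicial_closure k K"
proof
  fix x assume "x \<in> k"
  then have "x ^ (max 1 CHAR('a) ^ 0) \<in> k"
    by simp
  then show "x \<in> radicial_closure k K"
    unfolding radicial_closure_def purely_inseparable_over_def using \<open>x \<in> k\<close> assms by blast
qed

lemma radicial_closure_mono: "k \<subseteq> A \<Longrightarrow> radicial_closure k K \<subseteq> radicial_closure A K"
  unfolding radicial_closure_def purely_inseparable_over_def by blast

locale separable_radicial =
  fixes k K T U :: "'a::field set"
  assumes k: "is_subfield k" and K: "is_subfield K" and kK: "k \<subseteq> K"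
    and p: "prime CHAR('a)" and alg: "x \<in> K \<Longrightarrow> algebraic_over k x"
    and T_def: "T = separable_closure k K" and U_def: "U = radicial_closure k K"
begin

lemmas k_ring = is_subfieldD(1)[OF k]
lemmas K_ring = is_subfieldD(1)[OF K]

lemma mem_T: "x \<in> T \<longleftrightarrow> x \<in> K \<and> separable_over k x"
  by (simp add: T_def separable_closure_def)

lemma mem_U: "x \<in> U \<longleftrightarrow> x \<in> K \<and> (\<exists>n. x ^ (CHAR('a) ^ n) \<in> k)"
  using prime_gt_0_nat[OF p] by (simp add: U_def radicial_closure_def purely_inseparable_over_def max_def)

lemma T_in_subalgs: "T \<in> subalgs k K"
proof -
  have "is_subring T"
    unfolding T_def separable_closure_def by (rule is_subring_separable[OF k p K_ring kK alg])
  then show ?thesis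
    using kK separable_over_base[OF k] by (auto simp: subalgs_def mem_T)
qed

lemma U_in_subalgs: "U \<in> subalgs k K"
  using is_subring_radicial_closure[OF k_ring K_ring kK] subset_radicial_closure[OF kK]
  by (auto simp: subalgs_def U_def radicial_closure_def)

lemma is_subfield_if_in_subalgs: "L \<in> subalgs k K \<Longrightarrow> is_subfield L"
  using is_subfield_between[OF k] alg by (auto simp: subalgs_def)

lemma T_Int_U: "T \<inter> U = k"
  using separable_radical[OF k p] T_in_subalgs U_in_subalgs by (auto simp: mem_T mem_U subalgs_def)

lemma power_in_T: "x \<in> K \<Longrightarrow> \<exists>n. x ^ (CHAR('a) ^ n) \<in> T"
  using separable_over_power[OF k p alg] is_subringD(7)[OF K_ring] unfolding mem_T by metis

lemma height_one_in_U:
  assumes "U \<noteq> k"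
  obtains u where "u \<in> U" "u \<notin> T" "u ^ CHAR('a) \<in> k"
proof -
  obtain z where z: "z \<in> U" "z \<notin> k"
    using assms U_in_subalgs by (auto simp: subalgs_def)
  then obtain n where n: "z ^ (CHAR('a) ^ n) \<in> k"
    by (auto simp: mem_U)
  have "is_subring U"
    using U_in_subalgs by (simp add: subalgs_def)
  then obtain u where "u \<in> U" "u \<notin> k" "u ^ CHAR('a) \<in> k"
    by (rule radical_height_one[OF _ z n])
  then show ?thesis
    using T_Int_U that by blast
qed

text \<open>By minimality \<open>U\<close> is generated over \<open>k\<close> by one element of
  height one outside \<open>T\<close>, so \<open>linearly_disjoint_adjoin_radical\<close>
  applies.\<close>

lemma linearly_disjoint_if_minimal:
  assumes "minimal_ext k U"
  shows "linearly_disjoint k T U"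
proof -
  obtain u where u: "u \<in> U" "u \<notin> T" "u ^ CHAR('a) \<in> k"
    using height_one_in_U assms unfolding minimal_ext_def by metis
  have "adjoin k u \<in> subalgs k U"
    using is_subring_adjoin[OF k_ring] subset_adjoin[OF k_ring] adjoin_least[OF _ _ u(1)] U_in_subalgs
    by (auto simp: subalgs_def)
  moreover have "adjoin k u \<noteq> k"
    using adjoin_self[OF k_ring] u(2) T_in_subalgs by (auto simp: subalgs_def)
  ultimately have "adjoin k u = U"
    using assms unfolding minimal_ext_def by blast
  then show ?thesis
    using linearly_disjoint_adjoin_radical[OF k_ring is_subfield_if_in_subalgs[OF T_in_subalgs] _ p u(3,2)]
      T_in_subalgs by (auto simp: subalgs_def)
qed

lemma compositum_T_U:
  assumes "U \<noteq> k" "minimal_ext T K"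
  shows "compositum T U = K"
proof -
  have "\<not> U \<subseteq> T"
    using T_Int_U assms(1) by blast
  moreover have "compositum T U \<in> subalgs T K"
    using compositum_in_subalgs[OF T_in_subalgs U_in_subalgs K_ring] compositum_upper[of T U]
    by (auto simp: subalgs_def)
  ultimately show ?thesis
    using assms(2) compositum_upper(2)[of U T] unfolding minimal_ext_def by blast
qed

text \<open>Both \<open>U\<close> over \<open>k\<close> and \<open>K\<close> over \<open>T\<close>
  are radicial, and the intervals inherit the Boolean property.\<close>

lemma minimal_if_boolean:
  assumes B: "boolean_ext k K" and ne: "U \<noteq> k" "T \<noteq> K"
  shows "minimal_ext k U" "minimal_ext T K"
proof -
  show "minimal_ext k U"
    using U_in_subalgs ne(1) boolean_ext_lower[OF B U_in_subalgs] mem_U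
    by (intro minimal_ext_if_boolean_radical[OF k _ _ p]) (auto simp: subalgs_def)
  show "minimal_ext T K"
    using T_in_subalgs ne(2) boolean_ext_upper[OF B K_ring T_in_subalgs] power_in_T
    by (intro minimal_ext_if_boolean_radical[OF is_subfield_if_in_subalgs[OF T_in_subalgs] K_ring _ p])
      (auto simp: subalgs_def)
qed

text \<open>By minimality \<open>L \<inter> U\<close> is \<open>k\<close> or \<open>U\<close>. In
  the first case, distributing \<open>L\<close> over \<open>TU = K\<close> leaves only
  \<open>L \<inter> T\<close>.\<close>

lemma subalgs_split_if_boolean:
  assumes B: "boolean_ext k K" and ne: "U \<noteq> k" and min: "minimal_ext k U" "minimal_ext T K"
  shows "subalgs k K = subalgs k T \<union> subalgs U K"
proof
  show "subalgs k T \<union> subalgs U K \<subseteq> subalgs k K"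
    using T_in_subalgs U_in_subalgs by (auto simp: subalgs_def)
  show "subalgs k K \<subseteq> subalgs k T \<union> subalgs U K"
  proof
    fix L assume L: "L \<in> subalgs k K"
    have "L \<inter> U \<in> subalgs k U"
      using Int_in_subalgs[OF L U_in_subalgs] by (auto simp: subalgs_def)
    then consider "L \<inter> U = k" | "L \<inter> U = U"
      using min(1) by (auto simp: minimal_ext_def)
    then show "L \<in> subalgs k T \<union> subalgs U K"
    proof cases
      case 1
      have "L = L \<inter> compositum T U"
        using L compositum_T_U[OF ne min(2)] by (auto simp: subalgs_def)
      also have "\<dots> = compositum (L \<inter> T) k"
        using boolean_ext_distrib[OF B L T_in_subalgs U_in_subalgs] 1 by simp
      also have "\<dots> = L \<inter> T"
        using Int_in_subalgs[OF L T_in_subalgs] by (intro compositum_absorb1) (auto simp: subalgs_def)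
      finally show ?thesis
        using L by (auto simp: subalgs_def)
    next
      case 2
      then show ?thesis
        using L by (auto simp: subalgs_def)
    qed
  qed
qed

text \<open>The compositum \<open>AU\<close> is radicial over \<open>A\<close>, whereas elements of
  \<open>T\<close> are separable over \<open>A\<close>.\<close>

lemma compositum_Int_T:
  assumes A: "A \<in> subalgs k T"
  shows "compositum A U \<inter> T = A"
proof
  have AK: "A \<in> subalgs k K"
    using A T_in_subalgs by (auto simp: subalgs_def)
  note FA = is_subfield_if_in_subalgs[OF AK]
  note RA = is_subfieldD(1)[OF FA]
  have "A \<subseteq> radicial_closure A K" "U \<subseteq> radicial_closure A K"
    using AK subset_radicial_closure[of A K] radicial_closure_mono[of k A K]
    by (auto simp: U_def subalgs_def)
  moreover have "is_subring (radicial_closure A K)"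
    using is_subring_radicial_closure[OF RA K_ring] AK by (auto simp: subalgs_def)
  ultimately have rad: "compositum A U \<subseteq> radicial_closure A K"
    by (intro compositum_least)
  show "compositum A U \<inter> T \<subseteq> A"
  proof
    fix z assume z: "z \<in> compositum A U \<inter> T"
    then obtain n where "z ^ (CHAR('a) ^ n) \<in> A"
      using rad prime_gt_0_nat[OF p]
      by (auto simp: radicial_closure_def purely_inseparable_over_def max_def split: if_splits)
    moreover have "separable_over A z"
      using z separable_over_mono[OF k FA] AK by (auto simp: mem_T subalgs_def)
    ultimately show "z \<in> A"
      using separable_radical[OF FA p] by blast
  qed
  show "A \<subseteq> compositum A U \<inter> T"
    using A compositum_upper(1)[of A U] by (auto simp: subalgs_def)
qed

text \<open>An element of \<open>L\<close> is separable over \<open>U\<close> because \<open>K = TU\<close>, and radicial over \<open>L \<inter> T\<close>.\<close>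

lemma compositum_Int_T_U:
  assumes KTU: "compositum T U = K" and L: "L \<in> subalgs U K"
  shows "compositum (L \<inter> T) U = L"
proof
  have LK: "L \<in> subalgs k K"
    using L U_in_subalgs by (auto simp: subalgs_def)
  show "compositum (L \<inter> T) U \<subseteq> L"
    using L by (intro compositum_least) (auto simp: subalgs_def)
  define M where "M = compositum (L \<inter> T) U"
  have "M \<in> subalgs k K"
    unfolding M_def by (intro compositum_in_subalgs Int_in_subalgs LK T_in_subalgs U_in_subalgs K_ring)
  then have M: "is_subfield M"
    by (rule is_subfield_if_in_subalgs)
  have FU: "is_subfield U" and kU: "k \<subseteq> U"
    using is_subfield_if_in_subalgs U_in_subalgs by (auto simp: subalgs_def)
  have UM: "U \<subseteq> M"
    unfolding M_def by (rule compositum_upper)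
  have "is_subring {x \<in> K. separable_over U x}"
    using U_in_subalgs algebraic_over_mono[OF kU alg]
    by (intro is_subring_separable[OF FU p K_ring]) (auto simp: subalgs_def)
  moreover have "T \<subseteq> {x \<in> K. separable_over U x}"
    using separable_over_mono[OF k FU kU] by (auto simp: mem_T)
  moreover have "U \<subseteq> {x \<in> K. separable_over U x}"
    using separable_over_base[OF FU] U_in_subalgs by (auto simp: subalgs_def)
  ultimately have "K \<subseteq> {x \<in> K. separable_over U x}"
    using compositum_least[of "{x \<in> K. separable_over U x}" T U] KTU by simp
  then have sep: "separable_over M z" if "z \<in> K" for z
    using that separable_over_mono[OF FU M UM] by blast
  show "L \<subseteq> compositum (L \<inter> T) U"
  proof
    fix z assume z: "z \<in> L"
    then have zK: "z \<in> K"
      using LK by (auto simp: subalgs_def)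
    then obtain n where "z ^ (CHAR('a) ^ n) \<in> T"
      using power_in_T by blast
    moreover have "z ^ (CHAR('a) ^ n) \<in> L"
      using z LK is_subringD(7) by (auto simp: subalgs_def)
    ultimately have "z ^ (CHAR('a) ^ n) \<in> M"
      using compositum_upper(1)[of "L \<inter> T" U] by (auto simp: M_def)
    then show "z \<in> compositum (L \<inter> T) U"
      using separable_radical[OF M p sep[OF zK]] by (simp add: M_def)
  qed
qed

section \<open>The lattice \<open>[k, K]\<close> as a product of \<open>[k, T]\<close> and a
  two-element chain\<close>

context
  assumes U_ne: "U \<noteq> k" and minimal: "minimal_ext k U" "minimal_ext T K"
    and split: "subalgs k K = subalgs k T \<union> subalgs U K"
begin

lemma not_U_subset_T: "\<not> U \<subseteq> T"
  using T_Int_U U_ne by auto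

lemma subset_T_if_not_U: "L \<in> subalgs k K \<Longrightarrow> \<not> U \<subseteq> L \<Longrightarrow> L \<subseteq> T"
  unfolding split by (auto simp: subalgs_def)

lemma subset_compositum_Int_T_U:
  assumes "L \<in> subalgs k K"
  shows "L \<subseteq> compositum (L \<inter> T) U"
proof (cases "U \<subseteq> L")
  case True
  then have "L \<in> subalgs U K"
    using assms by (simp add: subalgs_def)
  then show ?thesis
    using compositum_Int_T_U[OF compositum_T_U[OF U_ne minimal(2)]] by simp
next
  case False
  then show ?thesis
    using subset_T_if_not_U[OF assms] compositum_upper(1)[of "L \<inter> T" U] by (simp add: inf.absorb1)
qed

text \<open>The coordinates \<open>L \<inter> T\<close> and \<open>U \<subseteq> L\<close> recover
  \<open>L\<close>: it is \<open>(L \<inter> T)U\<close> if it contains \<open>U\<close>, and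
  \<open>L \<inter> T\<close> otherwise.\<close>

lemma subalgs_eqI:
  assumes L: "L \<in> subalgs k K" and M: "M \<in> subalgs k K"
    and eq: "L \<inter> T = M \<inter> T" "U \<subseteq> L \<longleftrightarrow> U \<subseteq> M"
  shows "L = M"
proof (cases "U \<subseteq> L")
  case True
  then have "L \<in> subalgs U K" "M \<in> subalgs U K"
    using L M eq(2) by (simp_all add: subalgs_def)
  then show ?thesis
    using compositum_Int_T_U[OF compositum_T_U[OF U_ne minimal(2)]] eq(1) by metis
next
  case False
  then show ?thesis
    using subset_T_if_not_U[OF L] subset_T_if_not_U[OF M] eq by (simp add: inf.absorb1)
qed

lemma Int_T_in_subalgs: "L \<in> subalgs k K \<Longrightarrow> L \<inter> T \<in> subalgs k T"
  using Int_in_subalgs[OF _ T_in_subalgs] by (simp add: subalgs_def)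

text \<open>Both \<open>B\<close> and \<open>C\<close> lie in \<open>DU\<close>, where
  \<open>D\<close> is the right-hand side, and \<open>DU\<close> meets \<open>T\<close> only in
  \<open>D\<close>.\<close>

lemma compositum_Int_T_distrib:
  assumes B: "B \<in> subalgs k K" and C: "C \<in> subalgs k K"
  shows "compositum B C \<inter> T = compositum (B \<inter> T) (C \<inter> T)"
proof
  let ?D = "compositum (B \<inter> T) (C \<inter> T)"
  have RT: "is_subring T"
    using T_in_subalgs by (simp add: subalgs_def)
  have D: "?D \<in> subalgs k T"
    by (rule compositum_in_subalgs[OF Int_T_in_subalgs[OF B] Int_T_in_subalgs[OF C] RT])
  have "B \<subseteq> compositum ?D U" "C \<subseteq> compositum ?D U"
    using subset_compositum_Int_T_U[OF B] subset_compositum_Int_T_U[OF C]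
      compositum_mono[OF compositum_upper(1) order.refl, of "B \<inter> T" U "C \<inter> T"]
      compositum_mono[OF compositum_upper(2) order.refl, of "C \<inter> T" U "B \<inter> T"] by simp_all
  then have "compositum B C \<subseteq> compositum ?D U"
    by (intro compositum_least is_subring_compositum)
  then show "compositum B C \<inter> T \<subseteq> ?D"
    using compositum_Int_T[OF D] by auto
  have "?D \<subseteq> compositum B C"
    by (intro compositum_mono) auto
  moreover have "?D \<subseteq> T"
    by (intro compositum_least RT) auto
  ultimately show "?D \<subseteq> compositum B C \<inter> T"
    by simp
qed

text \<open>If neither contains \<open>U\<close>, then by the splitting both lie in
  \<open>T\<close>, and so does their compositum; but \<open>U\<close> does not.\<close>

lemma U_subset_compositum_iff:
  assumes B: "B \<in> subalgs k K" and C: "C \<in> subalgs k K"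
  shows "U \<subseteq> compositum B C \<longleftrightarrow> U \<subseteq> B \<or> U \<subseteq> C"
proof
  assume U: "U \<subseteq> compositum B C"
  show "U \<subseteq> B \<or> U \<subseteq> C"
  proof (rule ccontr)
    assume "\<not> ?thesis"
    then have "B \<subseteq> T" "C \<subseteq> T"
      using subset_T_if_not_U B C by simp_all
    moreover have "is_subring T"
      using T_in_subalgs by (simp add: subalgs_def)
    ultimately have "compositum B C \<subseteq> T"
      by (intro compositum_least)
    then show False
      using U not_U_subset_T by simp
  qed
next
  assume "U \<subseteq> B \<or> U \<subseteq> C"
  then show "U \<subseteq> compositum B C"
    using compositum_upper[where V = B and W = C] by auto
qed

lemma compositum_eq_K:
  assumes "V \<in> subalgs k K" "W \<in> subalgs k K" "T \<subseteq> compositum V W" "U \<subseteq> compositum V W"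
  shows "compositum V W = K"
proof
  show "compositum V W \<subseteq> K"
    using assms(1,2) by (intro compositum_least K_ring) (simp_all add: subalgs_def)
  show "K \<subseteq> compositum V W"
    using compositum_least[OF is_subring_compositum assms(3,4)] compositum_T_U[OF U_ne minimal(2)] by simp
qed

text \<open>Distributivity is checked on the two coordinates of \<open>subalgs_eqI\<close>.\<close>

lemma boolean_if_conditions:
  assumes BT: "boolean_ext k T"
  shows "boolean_ext k K"
  unfolding boolean_ext_def
proof (intro conjI ballI)
  fix A B C assume A: "A \<in> subalgs k K" and B: "B \<in> subalgs k K" and C: "C \<in> subalgs k K"
  note AB = Int_in_subalgs[OF A B] and AC = Int_in_subalgs[OF A C]
  show "A \<inter> compositum B C = compositum (A \<inter> B) (A \<inter> C)"
  proof (rule subalgs_eqI)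
    show "A \<inter> compositum B C \<in> subalgs k K" "compositum (A \<inter> B) (A \<inter> C) \<in> subalgs k K"
      by (intro Int_in_subalgs compositum_in_subalgs A B C K_ring)+
    have "A \<inter> compositum B C \<inter> T = (A \<inter> T) \<inter> (compositum B C \<inter> T)"
      by blast
    also have "\<dots> = compositum (A \<inter> T \<inter> (B \<inter> T)) (A \<inter> T \<inter> (C \<inter> T))"
      unfolding compositum_Int_T_distrib[OF B C]
      by (rule boolean_ext_distrib[OF BT]) (intro Int_T_in_subalgs A B C)+
    also have "\<dots> = compositum (A \<inter> B \<inter> T) (A \<inter> C \<inter> T)"
      by (intro arg_cong2[of _ _ _ _ compositum]) auto
    also have "\<dots> = compositum (A \<inter> B) (A \<inter> C) \<inter> T"
      by (rule compositum_Int_T_distrib[OF AB AC, symmetric])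
    finally show "A \<inter> compositum B C \<inter> T = compositum (A \<inter> B) (A \<inter> C) \<inter> T" .
    show "U \<subseteq> A \<inter> compositum B C \<longleftrightarrow> U \<subseteq> compositum (A \<inter> B) (A \<inter> C)"
      using U_subset_compositum_iff[OF B C] U_subset_compositum_iff[OF AB AC] by auto
  qed
next
  fix V assume V: "V \<in> subalgs k K"
  obtain W where W: "W \<in> subalgs k T" "V \<inter> T \<inter> W = k" "compositum (V \<inter> T) W = T"
    by (rule boolean_ext_complement[OF BT Int_T_in_subalgs[OF V]])
  have WK: "W \<in> subalgs k K" and WT: "W \<subseteq> T"
    using W(1) T_in_subalgs by (auto simp: subalgs_def)
  \<comment> \<open>The complement pairs \<open>W\<close> with the opposite second coordinate: it is
    \<open>W\<close> if \<open>U \<subseteq> V\<close>, and \<open>WU\<close> otherwise.\<close>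
  show "\<exists>V'. is_complement k K V V'"
  proof (cases "U \<subseteq> V")
    case True
    have "compositum V W = K"
    proof (rule compositum_eq_K[OF V WK])
      show "T \<subseteq> compositum V W"
        using compositum_mono[of "V \<inter> T" V W W] W(3) by simp
      show "U \<subseteq> compositum V W"
        using True compositum_upper(1)[of V W] by simp
    qed
    moreover have "V \<inter> W = k"
      using W(2) WT by auto
    ultimately show ?thesis
      using V WK unfolding is_complement_def by blast
  next
    case False
    then have VT: "V \<subseteq> T"
      by (rule subset_T_if_not_U[OF V])
    let ?W = "compositum W U"
    have W': "?W \<in> subalgs k K"
      by (intro compositum_in_subalgs WK U_in_subalgs K_ring)
    have "compositum V ?W = K"
    proof (rule compositum_eq_K[OF V W'])
      show "T \<subseteq> compositum V ?W"
        using compositum_mono[of "V \<inter> T" V W ?W] W(3) compositum_upper(1)[of W U] by simp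
      show "U \<subseteq> compositum V ?W"
        using compositum_upper(2)[of U W] compositum_upper(2)[of ?W V] by simp
    qed
    moreover have "V \<inter> ?W = k"
      using compositum_Int_T[OF W(1)] VT W(2) by auto
    ultimately show ?thesis
      using V W' unfolding is_complement_def by blast
  qed
qed

lemma disjoint_subalgs: "subalgs k T \<inter> subalgs U K = {}"
  using not_U_subset_T by (auto simp: subalgs_def)

lemma U_complement_T: "is_complement k K T U"
  unfolding is_complement_def
  using T_in_subalgs U_in_subalgs T_Int_U compositum_T_U[OF U_ne minimal(2)] by simp

text \<open>The first coordinate of \<open>V\<close> is \<open>k\<close>, as for \<open>U\<close>;
  and since \<open>TV = K\<close> contains \<open>U\<close> while \<open>T\<close> does not,
  \<open>V\<close> must contain it.\<close>

lemma complement_T_unique: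
  assumes V: "is_complement k K T V"
  shows "V = U"
proof (rule subalgs_eqI)
  have V': "V \<in> subalgs k K" "T \<inter> V = k" "compositum T V = K"
    using V unfolding is_complement_def by blast+
  then show "V \<in> subalgs k K" "V \<inter> T = U \<inter> T"
    using T_Int_U by auto
  have "U \<subseteq> V"
    using U_subset_compositum_iff[OF T_in_subalgs V'(1)] V'(3) not_U_subset_T U_in_subalgs
    by (simp add: subalgs_def)
  then show "U \<subseteq> V \<longleftrightarrow> U \<subseteq> U"
    by simp
qed (rule U_in_subalgs)

end

end

theorem theorem4p2:
  fixes k K T U :: "'a::field set"
  assumes "is_subfield k" and "is_subfield K" and "k \<subset> K" and "FIP k K"
    and "T = separable_closure k K" and "U = radicial_closure k K"
    and "U \<notin> {k, K}" and "T \<notin> {k, K}"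
  shows "(boolean_ext k K \<longleftrightarrow>
            (minimal_ext k U \<and> minimal_ext T K) \<and>
            subalgs k K = subalgs k T \<union> subalgs U K \<and>
            linearly_disjoint k T U \<and>
            boolean_ext k T) \<and>
         ((minimal_ext k U \<and> minimal_ext T K) \<and>
            subalgs k K = subalgs k T \<union> subalgs U K \<and>
            linearly_disjoint k T U \<and>
            boolean_ext k T \<longrightarrow>
          subalgs k T \<inter> subalgs U K = {} \<and>
          is_complement k K T U \<and> (\<forall>V. is_complement k K T V \<longrightarrow> V = U))"
proof -
  have kK: "k \<subseteq> K" and ne: "U \<noteq> k" "T \<noteq> K"
    using assms by auto
  have K_ring: "is_subring K" and k_ring: "is_subring k"
    using assms is_subfieldD by auto
  \<comment> \<open>In characteristic \<open>0\<close> the characteristic exponent is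
    \<open>1\<close>, so that \<open>U\<close> would be \<open>k\<close>.\<close>
  have "CHAR('a) \<noteq> 0"
  proof
    assume "CHAR('a) = 0"
    then have "U = k"
      using kK by (auto simp: assms(6) radicial_closure_def purely_inseparable_over_def)
    then show False
      using ne by simp
  qed
  then have "prime CHAR('a)"
    using prime_CHAR_semidom[where ?'a = 'a] by simp
  then interpret separable_radicial k K T U
    using assms kK algebraic_over_if_FIP[OF k_ring K_ring kK] by unfold_locales auto
  show ?thesis
  proof (intro conjI iffI impI allI)
    assume B: "boolean_ext k K"
    note min = minimal_if_boolean[OF B ne]
    show "minimal_ext k U" "minimal_ext T K" "subalgs k K = subalgs k T \<union> subalgs U K"
      "linearly_disjoint k T U" "boolean_ext k T"
      by (fact min subalgs_split_if_boolean[OF B ne(1) min] linearly_disjoint_if_minimal[OF min(1)]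
          boolean_ext_lower[OF B T_in_subalgs])+
  qed (use ne boolean_if_conditions disjoint_subalgs U_complement_T complement_T_unique in \<open>blast+\<close>)
qed

end
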